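(* Let $F$ be a driver such that, for any $t,z,z'$, the map $f_{t,z,z'}:y\mapsto y-F(t,y,z,z')$ is quasi-surely a bijection $\mathbb{R}^K\to\mathbb{R}^K$. Then the $\mathcal{SL}$-BSDE with driver $F$, $$Y_{t+1}=Y_t-F(\omega,t,Y_t,Z_t,Z'_t)+Z_tM_{t+1}+Z'_tN_{t+1}-G_t(Z'_t),\qquad 0\le t<T,\qquad Y_T=Q,$$ has a unique solution $(Y,Z,Z')$ for any $Q\in L^1(\mathcal{F}_T)$.
   Context: Finite-state setting. $\mathcal{X}=(\mathcal{X}_t)$ is a discrete-time process taking values in the standard basis vectors of $\mathbb{R}^N$, $\mathbb{X}_t=\sum_{u=1}^t\mathcal{X}_u$, and $\mathcal{F}_t=\sigma(\mathcal{X}_1,\dots,\mathcal{X}_t)$ ($\mathcal{F}_0$ trivial), $\mathcal{F}=\mathcal{F}_\infty=\sigma(\bigcup_t\mathcal{F}_t)$. $^*$ denotes transpose. $m\mathcal{F}_t$ denotes the $\mathcal{F}_t$-measurable $\mathbb{R}\cup\{\pm\infty\}$-valued functions. $\mathcal{H}$ is a linear space of $\mathcal{F}$-measurable $\mathbb{R}$-valued functions on $\Omega$ containing the constants, with $|X|\in\mathcal{H}$ and $I_AX\in\mathcal{H}$ whenever $X\in\mathcal{H}$, $A\in\mathcal{F}$; $\mathcal{H}_t=\mathcal{H}\cap m\mathcal{F}_t$. $\mathcal{E}$ is an $\mathcal{SL}$-expectation: a family of maps $\mathcal{E}_t:\mathcal{H}\to\mathcal{H}_t$ such that for all $X,Y\in\mathcal{H}$,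 $s\le t$: (i) $X\ge Y$ implies $\mathcal{E}_t(X)\ge\mathcal{E}_t(Y)$; (ii) $\mathcal{E}_s(Y)=\mathcal{E}_s(\mathcal{E}_t(Y))$; (iii) $\mathcal{E}_t(I_AY)=I_A\mathcal{E}_t(Y)$ for $A\in\mathcal{F}_t$; (iv) $\mathcal{E}_t(Y)=Y$ for $Y\in\mathcal{H}_t$; (v) $\mathcal{E}_t(X+Y)\le\mathcal{E}_t(X)+\mathcal{E}_t(Y)$; (vi) $\mathcal{E}_t(\lambda Y)=\lambda^+\mathcal{E}_t(Y)+\lambda^-\mathcal{E}_t(-Y)$ for $\lambda\in\mathcal{H}_t$ with $\lambda Y\in\mathcal{H}$; (vii) if $X_i\in\mathcal{H}$ and $X_i(\omega)\downarrow0$ for every $\omega$, then $\mathcal{E}_0(X_i)\to0$. Write $\mathcal{E}=\mathcal{E}_0$. A statement holds quasi-surely (q.s.) if it holds outside a set $A$ with $\mathcal{E}(I_A)=0$. $L^1(\mathcal{F})$ is the completion of $\{X\in\mathcal{H}:\mathcal{E}(|X|)<\infty\}$ under $\|X\|_1=\mathcal{E}(|X|)$ (modulo equality in $\|\cdot\|_1$), $L^1(\mathcal{F}_t)=L^1(\mathcal{F})\cap m\mathcal{F}_t$, and $\mathcal{E}_t$ extends to $L^1$ by continuity; for vector-valued variables, operations are componentwise. An $\mathcal{SL}$-martingale is an adapted $L^1$ process with $X_s=\mathcal{E}_s(X_t)$ for $s\le t$; it is symmetric if $\mathcal{E}_s(X_t)=-\mathcal{E}_s(-X_t)$ for all $s,t$.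 Fix an invertible adapted bounded linear map $\Phi_u:\mathbb{R}^N\to\mathbb{R}^N$, represented by premultiplication by the matrix $[\mathbf{1}|(\phi^s_u)^*|(\phi'_u)^*]^*$, where $\mathbf{1}$ is a column of 1's, $\phi^s_u$ is an $M\times N$ matrix for some $0\le M\le N-1$, $\phi'_u$ is an $(N-M-1)\times N$ matrix, and $\sum_{0\le u<t}\phi^s_u(\mathbb{X}_{u+1}-\mathbb{X}_u)$ is a symmetric $\mathcal{SL}$-martingale. Set $M_{t+1}=\phi^s_t(\mathbb{X}_{t+1}-\mathbb{X}_t)$, $N_{t+1}=\phi'_t(\mathbb{X}_{t+1}-\mathbb{X}_t)$ and $G_t(z)=\mathcal{E}_t(zN_{t+1})$. $T$ is a finite deterministic time. A driver is a map $F:\Omega\times\{0,\dots,T-1\}\times\mathbb{R}^K\times\mathbb{R}^{K\times M}\times\mathbb{R}^{K\times(N-M-1)}\to\mathbb{R}^K$ with $F(\cdot,t,y,z,z')\in L^1(\mathcal{F}_t)$ for all $t,y,z,z'$ (the argument $\omega$ is often omitted). A solution of the $\mathcal{SL}$-BSDE is a triple $(Y,Z,Z')$ of adapted processes with values in $\mathbb{R}^K$, $\mathbb{R}^{K\times M}$, $\mathbb{R}^{K\times(N-M-1)}$ satisfying the displayed equation and terminal condition.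
   Formalization: Uniqueness is proved under an added condition: after every non-null event in F_t, t<T, each basis vector is a non-null next value of the process. Without it the triple (Y,Z,Z') need not be unique (N=2, M=0, K=T=1, X_1=e_1 q.s., F=z', Q=0). Existence needs no extra condition. *)

theory Defs
  imports "HOL-Analysis.Borel_Space" "Jordan_Normal_Form.Matrix"
begin

hide_type (open) Finite_Cartesian_Product.vec
no_notation vec_nth (infixl "$" 90)

text \<open>Vectors and matrices come from \<^theory>\<open>Jordan_Normal_Form.Matrix\<close>, because the dimensions
  $M$ and $N - M - 1$ are allowed to be $0$. The sample space is the whole type \<open>'w\<close>; time is
  \<^typ>\<open>nat\<close>, and the driving process \<open>X\<close> is only used at times $1, 2, \ldots$.\<close>


section \<open>The finite-state process and its filtration\<close>

definition basis_process :: "nat \<Rightarrow> (nat \<Rightarrow> 'w \<Rightarrow> real vec) \<Rightarrow> bool" where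
  "basis_process N X \<longleftrightarrow> (\<forall>t\<ge>1. \<forall>\<omega>. \<exists>i<N. X t \<omega> = unit_vec N i)"

definition cum_process :: "nat \<Rightarrow> (nat \<Rightarrow> 'w \<Rightarrow> real vec) \<Rightarrow> nat \<Rightarrow> 'w \<Rightarrow> real vec" where
  "cum_process N X t \<omega> = vec N (\<lambda>i. \<Sum>u\<in>{1..t}. X u \<omega> $ i)"

text \<open>As each \<open>X u\<close> takes finitely many values, its level sets generate $\sigma(X_u)$.\<close>

definition filt :: "(nat \<Rightarrow> 'w \<Rightarrow> real vec) \<Rightarrow> nat \<Rightarrow> 'w measure" where
  "filt X t = sigma UNIV {{\<omega>. X u \<omega> = v} | u v. 1 \<le> u \<and> u \<le> t}"

definition filt_inf :: "(nat \<Rightarrow> 'w \<Rightarrow> real vec) \<Rightarrow> 'w measure" where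
  "filt_inf X = sigma UNIV (\<Union>t. sets (filt X t))"

definition adapted_vec ::
  "nat \<Rightarrow> (nat \<Rightarrow> 'w \<Rightarrow> real vec) \<Rightarrow> nat set \<Rightarrow> (nat \<Rightarrow> 'w \<Rightarrow> real vec) \<Rightarrow> bool" where
  "adapted_vec n X I V \<longleftrightarrow>
     (\<forall>t\<in>I. (\<forall>\<omega>. V t \<omega> \<in> carrier_vec n) \<and>
            (\<forall>i<n. (\<lambda>\<omega>. V t \<omega> $ i) \<in> borel_measurable (filt X t)))"

definition adapted_mat ::
  "nat \<Rightarrow> nat \<Rightarrow> (nat \<Rightarrow> 'w \<Rightarrow> real vec) \<Rightarrow> nat set \<Rightarrow> (nat \<Rightarrow> 'w \<Rightarrow> real mat) \<Rightarrow> bool" where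
  "adapted_mat r c X I A \<longleftrightarrow>
     (\<forall>t\<in>I. (\<forall>\<omega>. A t \<omega> \<in> carrier_mat r c) \<and>
            (\<forall>i<r. \<forall>j<c. (\<lambda>\<omega>. A t \<omega> $$ (i, j)) \<in> borel_measurable (filt X t)))"


section \<open>Sublinear expectations\<close>

definition test_space :: "(nat \<Rightarrow> 'w \<Rightarrow> real vec) \<Rightarrow> ('w \<Rightarrow> real) set \<Rightarrow> bool" where
  "test_space X H \<longleftrightarrow>
     H \<subseteq> borel_measurable (filt_inf X) \<and>
     (\<forall>c. (\<lambda>_. c) \<in> H) \<and>
     (\<forall>f\<in>H. \<forall>g\<in>H. (\<lambda>\<omega>. f \<omega> + g \<omega>) \<in> H) \<and>
     (\<forall>c. \<forall>f\<in>H. (\<lambda>\<omega>. c * f \<omega>) \<in> H) \<and>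
     (\<forall>f\<in>H. (\<lambda>\<omega>. \<bar>f \<omega>\<bar>) \<in> H) \<and>
     (\<forall>f\<in>H. \<forall>A\<in>sets (filt_inf X). (\<lambda>\<omega>. indicat_real A \<omega> * f \<omega>) \<in> H)"

definition test_space_at ::
  "(nat \<Rightarrow> 'w \<Rightarrow> real vec) \<Rightarrow> ('w \<Rightarrow> real) set \<Rightarrow> nat \<Rightarrow> ('w \<Rightarrow> real) set" where
  "test_space_at X H t = H \<inter> borel_measurable (filt X t)"

text \<open>Only the values of \<open>E t\<close> on \<open>H\<close> are meaningful. As the initial \<open>\<sigma>\<close>-algebra is trivial,
  \<open>E 0 f\<close> is a constant function; it is never collapsed to a number below.\<close>

definition SL_expectation ::
  "(nat \<Rightarrow> 'w \<Rightarrow> real vec) \<Rightarrow> ('w \<Rightarrow> real) set \<Rightarrow> (nat \<Rightarrow> ('w \<Rightarrow> real) \<Rightarrow> 'w \<Rightarrow> real) \<Rightarrow> bool" where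
  "SL_expectation X H E \<longleftrightarrow>
     (\<forall>t. \<forall>f\<in>H. E t f \<in> test_space_at X H t) \<and>
     (\<forall>t. \<forall>f\<in>H. \<forall>g\<in>H. (\<forall>\<omega>. g \<omega> \<le> f \<omega>) \<longrightarrow> (\<forall>\<omega>. E t g \<omega> \<le> E t f \<omega>)) \<and>
     (\<forall>s t. s \<le> t \<longrightarrow> (\<forall>f\<in>H. E s f = E s (E t f))) \<and>
     (\<forall>t. \<forall>A\<in>sets (filt X t). \<forall>f\<in>H.
        E t (\<lambda>\<omega>. indicat_real A \<omega> * f \<omega>) = (\<lambda>\<omega>. indicat_real A \<omega> * E t f \<omega>)) \<and>
     (\<forall>t. \<forall>f\<in>test_space_at X H t. E t f = f) \<and>
     (\<forall>t. \<forall>f\<in>H. \<forall>g\<in>H. \<forall>\<omega>. E t (\<lambda>\<omega>. f \<omega> + g \<omega>) \<omega> \<le> E t f \<omega> + E t g \<omega>) \<and>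
     (\<forall>t. \<forall>l\<in>test_space_at X H t. \<forall>f\<in>H. (\<lambda>\<omega>. l \<omega> * f \<omega>) \<in> H \<longrightarrow>
        E t (\<lambda>\<omega>. l \<omega> * f \<omega>) =
          (\<lambda>\<omega>. max (l \<omega>) 0 * E t f \<omega> + max (- l \<omega>) 0 * E t (\<lambda>\<omega>. - f \<omega>) \<omega>)) \<and>
     (\<forall>f :: nat \<Rightarrow> 'w \<Rightarrow> real. (\<forall>i. f i \<in> H) \<and> (\<forall>\<omega>. decseq (\<lambda>i. f i \<omega>) \<and> (\<lambda>i. f i \<omega>) \<longlonglongrightarrow> 0)
        \<longrightarrow> (\<forall>\<omega>. (\<lambda>i. E 0 (f i) \<omega>) \<longlonglongrightarrow> 0))"

definition null_event ::
  "(nat \<Rightarrow> 'w \<Rightarrow> real vec) \<Rightarrow> (nat \<Rightarrow> ('w \<Rightarrow> real) \<Rightarrow> 'w \<Rightarrow> real) \<Rightarrow> 'w set \<Rightarrow> bool" where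
  "null_event X E A \<longleftrightarrow> A \<in> sets (filt_inf X) \<and> E 0 (indicat_real A) = (\<lambda>_. 0)"

definition quasi_surely ::
  "(nat \<Rightarrow> 'w \<Rightarrow> real vec) \<Rightarrow> (nat \<Rightarrow> ('w \<Rightarrow> real) \<Rightarrow> 'w \<Rightarrow> real) \<Rightarrow> ('w \<Rightarrow> bool) \<Rightarrow> bool" where
  "quasi_surely X E P \<longleftrightarrow> (\<exists>A. null_event X E A \<and> (\<forall>\<omega>. \<omega> \<notin> A \<longrightarrow> P \<omega>))"


section \<open>The space L1 and the extension of the expectations\<close>

text \<open>Elements of the completion are represented by functions: every $\|\cdot\|_1$-Cauchy sequence in
  \<open>H\<close> has a quasi-surely convergent subsequence, and its limit, which is quasi-surely finite,
  determines the class. Hence real-valued representatives suffice, and two of them are equal in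
  $\|\cdot\|_1$ iff they agree quasi-surely. Since \<open>E 0\<close> is real-valued on \<open>H\<close>, the restriction
  $E(|f|) < \infty$ is void.\<close>

definition L1_approx ::
  "(nat \<Rightarrow> 'w \<Rightarrow> real vec) \<Rightarrow> ('w \<Rightarrow> real) set \<Rightarrow> (nat \<Rightarrow> ('w \<Rightarrow> real) \<Rightarrow> 'w \<Rightarrow> real) \<Rightarrow>
   (nat \<Rightarrow> 'w \<Rightarrow> real) \<Rightarrow> ('w \<Rightarrow> real) \<Rightarrow> bool" where
  "L1_approx X H E h f \<longleftrightarrow>
     (\<forall>n. h n \<in> H) \<and>
     (\<forall>e>0. \<exists>n0. \<forall>m\<ge>n0. \<forall>n\<ge>n0. \<forall>\<omega>. E 0 (\<lambda>\<omega>. \<bar>h m \<omega> - h n \<omega>\<bar>) \<omega> < e) \<and>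
     quasi_surely X E (\<lambda>\<omega>. (\<lambda>n. h n \<omega>) \<longlonglongrightarrow> f \<omega>)"

definition L1 ::
  "(nat \<Rightarrow> 'w \<Rightarrow> real vec) \<Rightarrow> ('w \<Rightarrow> real) set \<Rightarrow> (nat \<Rightarrow> ('w \<Rightarrow> real) \<Rightarrow> 'w \<Rightarrow> real) \<Rightarrow>
   ('w \<Rightarrow> real) set" where
  "L1 X H E = {f \<in> borel_measurable (filt_inf X). \<exists>h. L1_approx X H E h f}"

definition L1_at ::
  "(nat \<Rightarrow> 'w \<Rightarrow> real vec) \<Rightarrow> ('w \<Rightarrow> real) set \<Rightarrow> (nat \<Rightarrow> ('w \<Rightarrow> real) \<Rightarrow> 'w \<Rightarrow> real) \<Rightarrow>
   nat \<Rightarrow> ('w \<Rightarrow> real) set" where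
  "L1_at X H E t = L1 X H E \<inter> borel_measurable (filt X t)"

text \<open>Outside \<open>H\<close> the extension is only determined up to quasi-sure equality; \<open>SOME\<close> picks a
  version.\<close>

definition E_ext ::
  "(nat \<Rightarrow> 'w \<Rightarrow> real vec) \<Rightarrow> ('w \<Rightarrow> real) set \<Rightarrow> (nat \<Rightarrow> ('w \<Rightarrow> real) \<Rightarrow> 'w \<Rightarrow> real) \<Rightarrow>
   nat \<Rightarrow> ('w \<Rightarrow> real) \<Rightarrow> 'w \<Rightarrow> real" where
  "E_ext X H E t f =
     (if f \<in> H then E t f
      else SOME g. g \<in> L1_at X H E t \<and>
             (\<exists>h. L1_approx X H E h f \<and> L1_approx X H E (\<lambda>n. E t (h n)) g))"

definition SL_martingale ::
  "(nat \<Rightarrow> 'w \<Rightarrow> real vec) \<Rightarrow> ('w \<Rightarrow> real) set \<Rightarrow> (nat \<Rightarrow> ('w \<Rightarrow> real) \<Rightarrow> 'w \<Rightarrow> real) \<Rightarrow>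
   (nat \<Rightarrow> 'w \<Rightarrow> real) \<Rightarrow> bool" where
  "SL_martingale X H E S \<longleftrightarrow>
     (\<forall>t. S t \<in> L1_at X H E t) \<and>
     (\<forall>s t. s \<le> t \<longrightarrow> quasi_surely X E (\<lambda>\<omega>. S s \<omega> = E_ext X H E s (S t) \<omega>))"

definition symmetric_SL_martingale ::
  "(nat \<Rightarrow> 'w \<Rightarrow> real vec) \<Rightarrow> ('w \<Rightarrow> real) set \<Rightarrow> (nat \<Rightarrow> ('w \<Rightarrow> real) \<Rightarrow> 'w \<Rightarrow> real) \<Rightarrow>
   (nat \<Rightarrow> 'w \<Rightarrow> real) \<Rightarrow> bool" where
  "symmetric_SL_martingale X H E S \<longleftrightarrow>
     SL_martingale X H E S \<and>
     (\<forall>s t. quasi_surely X E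
        (\<lambda>\<omega>. E_ext X H E s (S t) \<omega> = - E_ext X H E s (\<lambda>\<omega>. - S t \<omega>) \<omega>))"


section \<open>The backward stochastic difference equation\<close>

text \<open>\<open>incr N X \<phi> t\<close> is $\phi_t(\mathbb{X}_{t+1} - \mathbb{X}_t)$, that is, $M_{t+1}$ for
  $\phi = \phi^s$ and $N_{t+1}$ for $\phi = \phi'$. Note the shift of the index.\<close>

definition incr ::
  "nat \<Rightarrow> (nat \<Rightarrow> 'w \<Rightarrow> real vec) \<Rightarrow> (nat \<Rightarrow> 'w \<Rightarrow> real mat) \<Rightarrow> nat \<Rightarrow> 'w \<Rightarrow> real vec" where
  "incr N X \<phi> t \<omega> = \<phi> t \<omega> *\<^sub>v (cum_process N X (Suc t) \<omega> - cum_process N X t \<omega>)"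

definition stacked :: "nat \<Rightarrow> real mat \<Rightarrow> real mat \<Rightarrow> real mat" where
  "stacked N A B = mat_of_rows N (vec N (\<lambda>_. 1) # rows A @ rows B)"

definition basis_change ::
  "nat \<Rightarrow> nat \<Rightarrow> (nat \<Rightarrow> 'w \<Rightarrow> real vec) \<Rightarrow> ('w \<Rightarrow> real) set \<Rightarrow>
   (nat \<Rightarrow> ('w \<Rightarrow> real) \<Rightarrow> 'w \<Rightarrow> real) \<Rightarrow>
   (nat \<Rightarrow> 'w \<Rightarrow> real mat) \<Rightarrow> (nat \<Rightarrow> 'w \<Rightarrow> real mat) \<Rightarrow> bool" where
  "basis_change N M X H E \<phi>s \<phi>' \<longleftrightarrow>
     adapted_mat M N X UNIV \<phi>s \<and>
     adapted_mat (N - M - 1) N X UNIV \<phi>' \<and>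
     (\<forall>u \<omega>. invertible_mat (stacked N (\<phi>s u \<omega>) (\<phi>' u \<omega>))) \<and>
     (\<forall>u. \<exists>C. \<forall>\<omega>. \<forall>i<N. \<forall>j<N. \<bar>stacked N (\<phi>s u \<omega>) (\<phi>' u \<omega>) $$ (i, j)\<bar> \<le> C) \<and>
     (\<forall>i<M. symmetric_SL_martingale X H E (\<lambda>t \<omega>. \<Sum>u<t. incr N X \<phi>s u \<omega> $ i))"

text \<open>$G_t(z) = E_t(z N_{t+1})$, for a random matrix \<open>z\<close> with \<open>K\<close> rows.\<close>

definition G_map ::
  "nat \<Rightarrow> nat \<Rightarrow> (nat \<Rightarrow> 'w \<Rightarrow> real vec) \<Rightarrow> ('w \<Rightarrow> real) set \<Rightarrow>
   (nat \<Rightarrow> ('w \<Rightarrow> real) \<Rightarrow> 'w \<Rightarrow> real) \<Rightarrow> (nat \<Rightarrow> 'w \<Rightarrow> real mat) \<Rightarrow>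
   nat \<Rightarrow> ('w \<Rightarrow> real mat) \<Rightarrow> 'w \<Rightarrow> real vec" where
  "G_map K N X H E \<phi>' t z \<omega> =
     vec K (\<lambda>i. E_ext X H E t (\<lambda>\<omega>. (z \<omega> *\<^sub>v incr N X \<phi>' t \<omega>) $ i) \<omega>)"

text \<open>The component functions \<open>\<lambda>\<omega>. F \<omega> t y z z' $ i\<close> themselves, and not merely quasi-sure
  modifications of them, are measurable at time \<open>t\<close>. With modifications depending on \<open>y\<close>, the
  uncountably many exceptional sets could not be discarded.\<close>

definition driver ::
  "nat \<Rightarrow> nat \<Rightarrow> nat \<Rightarrow> nat \<Rightarrow> (nat \<Rightarrow> 'w \<Rightarrow> real vec) \<Rightarrow> ('w \<Rightarrow> real) set \<Rightarrow>
   (nat \<Rightarrow> ('w \<Rightarrow> real) \<Rightarrow> 'w \<Rightarrow> real) \<Rightarrow>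
   ('w \<Rightarrow> nat \<Rightarrow> real vec \<Rightarrow> real mat \<Rightarrow> real mat \<Rightarrow> real vec) \<Rightarrow> bool" where
  "driver K N M T X H E F \<longleftrightarrow>
     (\<forall>t<T. \<forall>y\<in>carrier_vec K. \<forall>z\<in>carrier_mat K M. \<forall>z'\<in>carrier_mat K (N - M - 1).
        (\<forall>\<omega>. F \<omega> t y z z' \<in> carrier_vec K) \<and>
        (\<forall>i<K. (\<lambda>\<omega>. F \<omega> t y z z' $ i) \<in> L1_at X H E t))"

text \<open>\<open>Y\<close> is indexed by $0, \ldots, T$, and \<open>Z\<close>, \<open>Z'\<close> by $0, \ldots, T - 1$.\<close>

definition BSDE_solution ::
  "nat \<Rightarrow> nat \<Rightarrow> nat \<Rightarrow> nat \<Rightarrow> (nat \<Rightarrow> 'w \<Rightarrow> real vec) \<Rightarrow> ('w \<Rightarrow> real) set \<Rightarrow>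
   (nat \<Rightarrow> ('w \<Rightarrow> real) \<Rightarrow> 'w \<Rightarrow> real) \<Rightarrow>
   (nat \<Rightarrow> 'w \<Rightarrow> real mat) \<Rightarrow> (nat \<Rightarrow> 'w \<Rightarrow> real mat) \<Rightarrow>
   ('w \<Rightarrow> nat \<Rightarrow> real vec \<Rightarrow> real mat \<Rightarrow> real mat \<Rightarrow> real vec) \<Rightarrow> ('w \<Rightarrow> real vec) \<Rightarrow>
   (nat \<Rightarrow> 'w \<Rightarrow> real vec) \<Rightarrow> (nat \<Rightarrow> 'w \<Rightarrow> real mat) \<Rightarrow> (nat \<Rightarrow> 'w \<Rightarrow> real mat) \<Rightarrow> bool" where
  "BSDE_solution K N M T X H E \<phi>s \<phi>' F Q Y Z Z' \<longleftrightarrow>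
     adapted_vec K X {..T} Y \<and>
     adapted_mat K M X {..<T} Z \<and>
     adapted_mat K (N - M - 1) X {..<T} Z' \<and>
     (\<forall>t<T. quasi_surely X E (\<lambda>\<omega>.
        Y (Suc t) \<omega> =
          Y t \<omega> - F \<omega> t (Y t \<omega>) (Z t \<omega>) (Z' t \<omega>)
          + Z t \<omega> *\<^sub>v incr N X \<phi>s t \<omega> + Z' t \<omega> *\<^sub>v incr N X \<phi>' t \<omega>
          - G_map K N X H E \<phi>' t (Z' t) \<omega>)) \<and>
     quasi_surely X E (\<lambda>\<omega>. Y T \<omega> = Q \<omega>)"

text \<open>Every state is a possible next value of \<open>X\<close> after every non-negligible history up to \<open>T\<close>. This
  makes the integrands $Z_t$, $Z'_t$ representing a given $Y_{t+1}$ unique. Without it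
  uniqueness fails even for \<open>Y\<close>: for $N = 2$, $M = 0$, $K = T = 1$, $\phi'_0 = [0, 1]$, $F = z'$,
  $Q = 0$ and $X_1 = e_1$ quasi-surely, each constant \<open>c\<close> gives the solution $Y_0 = Z'_0 = c$, $Y_1 = 0$.\<close>

definition nondegenerate ::
  "nat \<Rightarrow> nat \<Rightarrow> (nat \<Rightarrow> 'w \<Rightarrow> real vec) \<Rightarrow> (nat \<Rightarrow> ('w \<Rightarrow> real) \<Rightarrow> 'w \<Rightarrow> real) \<Rightarrow> bool" where
  "nondegenerate N T X E \<longleftrightarrow>
     (\<forall>t<T. \<forall>A\<in>sets (filt X t). \<forall>i<N.
        \<not> null_event X E A \<longrightarrow> \<not> null_event X E {\<omega>\<in>A. X (Suc t) \<omega> = unit_vec N i})"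

end

theory Submission
  imports Defs
begin

text \<open>Since the driving process takes finitely many values, each $\mathcal{F}_t$ has finitely many
  atoms, one for each history up to time $t$. So every $\mathcal{F}_t$-measurable function is simple
  and lies in \<open>H\<close>, the extension to $L^1$ plays no role, and the equation can be solved atom by atom,
  backwards in time. On an atom, $Y_{t+1}$ is a linear function $C \mathcal{X}_{t+1}$ of the next state.
  Invertibility of $\Phi_t$ gives $C = [a \mid Z_t \mid Z'_t] \Phi_t$, that is,
  $Y_{t+1} = a + Z_t M_{t+1} + Z'_t N_{t+1}$, and then $Y_t$ solves
  $Y_t - F(t, Y_t, Z_t, Z'_t) = a + G_t(Z'_t)$, which the bijectivity assumption makes possible on every
  atom that is not null. Uniqueness reverses these steps: nondegeneracy forces the two linear functions
  of $\mathcal{X}_{t+1}$ to agree on all of the states, hence to have the same matrix.\<close>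

section \<open>Histories\<close>

text \<open>The classes of this equivalence relation are the atoms of \<open>filt X t\<close>. Time
  0 is left out, so \<open>t = 0\<close> gives a single class, as the trivial initial
  \<sigma>-algebra requires.\<close>

definition same_history :: "(nat \<Rightarrow> 'w \<Rightarrow> real vec) \<Rightarrow> nat \<Rightarrow> 'w \<Rightarrow> 'w \<Rightarrow> bool" where
  "same_history X t \<omega> \<omega>' \<longleftrightarrow> (\<forall>u. 1 \<le> u \<longrightarrow> u \<le> t \<longrightarrow> X u \<omega> = X u \<omega>')"

text \<open>Takes the place of measurability at time \<open>t\<close>. It makes sense for any target
  type, so real, vector, matrix, set and predicate valued maps are treated alike.\<close>

definition history_det :: "(nat \<Rightarrow> 'w \<Rightarrow> real vec) \<Rightarrow> nat \<Rightarrow> ('w \<Rightarrow> 'a) \<Rightarrow> bool" where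
  "history_det X t f \<longleftrightarrow> (\<forall>\<omega> \<omega>'. same_history X t \<omega> \<omega>' \<longrightarrow> f \<omega> = f \<omega>')"

lemma same_history_refl [simp]: "same_history X t \<omega> \<omega>"
  by (simp add: same_history_def)

lemma same_history_sym: "same_history X t \<omega> \<omega>' \<Longrightarrow> same_history X t \<omega>' \<omega>"
  by (simp add: same_history_def)

lemma same_history_trans:
  "same_history X t \<omega> \<omega>' \<Longrightarrow> same_history X t \<omega>' \<omega>'' \<Longrightarrow> same_history X t \<omega> \<omega>''"
  by (simp add: same_history_def)

lemma same_history_Suc:
  "same_history X (Suc t) \<omega> \<omega>' \<longleftrightarrow> same_history X t \<omega> \<omega>' \<and> X (Suc t) \<omega> = X (Suc t) \<omega>'"
  by (auto simp: same_history_def le_Suc_eq)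

lemma history_detD: "history_det X t f \<Longrightarrow> same_history X t \<omega> \<omega>' \<Longrightarrow> f \<omega> = f \<omega>'"
  by (simp add: history_det_def)

text \<open>\<open>SOME\<close> depends on \<open>\<omega>\<close> only through the predicate
  \<open>P \<omega>\<close>, which is the same along equal histories. This replaces measurable
  selection throughout.\<close>

lemma history_det_choice:
  assumes "\<And>\<omega>. \<exists>x. P \<omega> x" and "history_det X t P"
  obtains f where "history_det X t f" "\<And>\<omega>. P \<omega> (f \<omega>)"
proof
  show "history_det X t (\<lambda>\<omega>. SOME x. P \<omega> x)"
    using assms(2) by (simp add: history_det_def)
  show "P \<omega> (SOME x. P \<omega> x)" for \<omega>
    using assms(1) by (rule someI_ex)
qed

section \<open>Measurability at a finite time as dependence on the history\<close>

lemma space_filt [simp]: "space (filt X t) = UNIV"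
  by (simp add: filt_def)

lemma space_filt_inf [simp]: "space (filt_inf X) = UNIV"
  by (simp add: filt_inf_def)

lemma sets_filt_subset_filt_inf: "A \<in> sets (filt X t) \<Longrightarrow> A \<in> sets (filt_inf X)"
  unfolding filt_inf_def by (subst sets_measure_of) auto

lemma level_set_in_filt: "1 \<le> u \<Longrightarrow> u \<le> t \<Longrightarrow> {\<omega>. X u \<omega> = v} \<in> sets (filt X t)"
  unfolding filt_def by (subst sets_measure_of) auto

text \<open>The generators are level sets of \<open>X u\<close> with \<open>u\<close> between 1 and
  \<open>t\<close>, and invariance under \<open>same_history\<close> survives complements and
  countable unions.\<close>

lemma history_det_of_sets_filt:
  assumes "A \<in> sets (filt X t)"
  shows "history_det X t (\<lambda>\<omega>. \<omega> \<in> A)"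
proof -
  have "A \<in> sigma_sets UNIV {{\<omega>. X u \<omega> = v} | u v. 1 \<le> u \<and> u \<le> t}"
    using assms unfolding filt_def by (subst (asm) sets_measure_of) auto
  then show ?thesis
  proof induction
    case (Union A)
    then have "\<omega> \<in> A i \<longleftrightarrow> \<omega>' \<in> A i" if "same_history X t \<omega> \<omega>'" for i \<omega> \<omega>'
      using Union.IH[of i] that by (simp add: history_det_def)
    then show ?case
      by (simp add: history_det_def)
  qed (auto simp: history_det_def same_history_def)
qed

lemma atom_in_sets_filt: "{\<omega>'. same_history X t \<omega> \<omega>'} \<in> sets (filt X t)"
proof -
  have "{\<omega>'\<in>space (filt X t). \<forall>u\<in>{1..t}. X u \<omega>' = X u \<omega>} \<in> sets (filt X t)"
    by (rule sets.sets_Collect_finite_All) (auto intro: level_set_in_filt)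
  also have "{\<omega>'\<in>space (filt X t). \<forall>u\<in>{1..t}. X u \<omega>' = X u \<omega>} = {\<omega>'. same_history X t \<omega> \<omega>'}"
    by (auto simp: same_history_def)
  finally show ?thesis .
qed

text \<open>A history is a word of length \<open>t\<close> over \<open>N\<close> unit vectors, so
  there are finitely many, and \<open>f\<close> factors through the history.\<close>

lemma finite_range_history_det:
  assumes "basis_process N X" and "history_det X t f"
  shows "finite (range f)"
proof -
  define h where "h \<omega> = map (\<lambda>u. X u \<omega>) [1..<Suc t]" for \<omega>
  have "range h \<subseteq> {xs. set xs \<subseteq> unit_vec N ` {..<N} \<and> length xs = t}"
    using assms(1) by (fastforce simp: h_def basis_process_def)
  then have "finite (range h)"
    by (rule finite_subset) (simp add: finite_lists_length_eq)
  \<comment> \<open>\<open>inv_into UNIV h\<close> picks one representative of each history.\<close>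
  moreover have "f \<omega> = f (inv_into UNIV h (h \<omega>))" for \<omega>
  proof (rule history_detD[OF assms(2)])
    have "h (inv_into UNIV h (h \<omega>)) = h \<omega>"
      by (simp add: f_inv_into_f)
    then show "same_history X t \<omega> (inv_into UNIV h (h \<omega>))"
      by (auto simp: h_def same_history_def simp del: upt_Suc)
  qed
  then have "range f \<subseteq> (f \<circ> inv_into UNIV h) ` range h"
    by auto
  ultimately show ?thesis
    by (meson finite_imageI finite_subset)
qed

text \<open>An invariant set is the union of its atoms, and there are only finitely many of
  these.\<close>

lemma sets_filt_iff:
  assumes "basis_process N X"
  shows "A \<in> sets (filt X t) \<longleftrightarrow> history_det X t (\<lambda>\<omega>. \<omega> \<in> A)"
proof
  assume A: "history_det X t (\<lambda>\<omega>. \<omega> \<in> A)"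
  \<comment> \<open>The map sending a point to its atom is itself constant on atoms, so it has
    finite range.\<close>
  have "history_det X t (\<lambda>\<omega>. {\<omega>'. same_history X t \<omega> \<omega>'})"
    unfolding history_det_def by (blast intro: same_history_sym same_history_trans)
  then have "finite ((\<lambda>\<omega>. {\<omega>'. same_history X t \<omega> \<omega>'}) ` A)"
    using finite_range_history_det[OF assms] by (meson finite_subset image_mono subset_UNIV)
  then have "\<Union> ((\<lambda>\<omega>. {\<omega>'. same_history X t \<omega> \<omega>'}) ` A) \<in> sets (filt X t)"
    by (rule sets.finite_Union) (auto intro: atom_in_sets_filt)
  also have "\<Union> ((\<lambda>\<omega>. {\<omega>'. same_history X t \<omega> \<omega>'}) ` A) = A"
    using A same_history_refl unfolding history_det_def by fast
  finally show "A \<in> sets (filt X t)" .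
qed (rule history_det_of_sets_filt)

text \<open>From left to right, the level set of \<open>f\<close> through \<open>\<omega>\<close> is
  measurable and hence invariant; from right to left, every preimage is invariant.\<close>

lemma borel_measurable_filt_iff:
  fixes f :: "'w \<Rightarrow> real"
  assumes "basis_process N X"
  shows "f \<in> borel_measurable (filt X t) \<longleftrightarrow> history_det X t f"
proof
  assume f: "f \<in> borel_measurable (filt X t)"
  show "history_det X t f"
    unfolding history_det_def
  proof (intro allI impI)
    fix \<omega> \<omega>' assume same: "same_history X t \<omega> \<omega>'"
    have "f -` {f \<omega>} \<inter> space (filt X t) \<in> sets (filt X t)"
      using f by (rule measurable_sets) simp
    from history_detD[OF history_det_of_sets_filt[OF this] same] show "f \<omega> = f \<omega>'"
      by simp
  qed
next
  assume "history_det X t f"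
  then show "f \<in> borel_measurable (filt X t)"
    by (intro measurableI) (auto simp: sets_filt_iff[OF assms] history_det_def)
qed

lemma adapted_vec_iff:
  assumes "basis_process N X"
  shows "adapted_vec n X I V \<longleftrightarrow>
    (\<forall>t\<in>I. (\<forall>\<omega>. V t \<omega> \<in> carrier_vec n) \<and> history_det X t (V t))"
proof -
  have "(\<forall>i<n. history_det X t (\<lambda>\<omega>. V t \<omega> $ i)) \<longleftrightarrow> history_det X t (V t)"
    if "\<forall>\<omega>. V t \<omega> \<in> carrier_vec n" for t
    unfolding history_det_def using that
    by (metis (no_types, lifting) carrier_vecD eq_vecI)
  then show ?thesis
    unfolding adapted_vec_def borel_measurable_filt_iff[OF assms] by blast
qed

lemma adapted_mat_iff:
  assumes "basis_process N X"
  shows "adapted_mat r c X I A \<longleftrightarrow>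
    (\<forall>t\<in>I. (\<forall>\<omega>. A t \<omega> \<in> carrier_mat r c) \<and> history_det X t (A t))"
proof -
  have "(\<forall>i<r. \<forall>j<c. history_det X t (\<lambda>\<omega>. A t \<omega> $$ (i, j))) \<longleftrightarrow> history_det X t (A t)"
    if "\<forall>\<omega>. A t \<omega> \<in> carrier_mat r c" for t
    unfolding history_det_def using that
    by (metis (no_types, lifting) carrier_matD eq_matI)
  then show ?thesis
    unfolding adapted_mat_def borel_measurable_filt_iff[OF assms] by blast
qed

text \<open>The cumulative sums telescope. As the next state is a unit vector, the increment is a
  column of \<open>\<phi> t \<omega>\<close>.\<close>

lemma incr_eq:
  assumes "basis_process N X"
  shows "incr N X \<phi> t \<omega> = \<phi> t \<omega> *\<^sub>v X (Suc t) \<omega>"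
proof -
  have "X (Suc t) \<omega> \<in> carrier_vec N"
    using assms unfolding basis_process_def by (metis le_add1 plus_1_eq_Suc unit_vec_carrier)
  then have "cum_process N X (Suc t) \<omega> - cum_process N X t \<omega> = X (Suc t) \<omega>"
    by (intro eq_vecI) (auto simp: cum_process_def)
  then show ?thesis
    by (simp add: incr_def)
qed


section \<open>Localisation and null events\<close>

locale sublinear_setting =
  fixes N :: nat
    and X :: "nat \<Rightarrow> 'w \<Rightarrow> real vec"
    and H :: "('w \<Rightarrow> real) set"
    and E :: "nat \<Rightarrow> ('w \<Rightarrow> real) \<Rightarrow> 'w \<Rightarrow> real"
  assumes basis: "basis_process N X"
    and test: "test_space X H"
    and SL: "SL_expectation X H E"
begin

lemma const_in_H: "(\<lambda>_. c) \<in> H"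
  using test by (simp add: test_space_def)

lemma add_in_H: "f \<in> H \<Longrightarrow> g \<in> H \<Longrightarrow> (\<lambda>\<omega>. f \<omega> + g \<omega>) \<in> H"
  using test by (simp add: test_space_def)

lemma scale_in_H: "f \<in> H \<Longrightarrow> (\<lambda>\<omega>. c * f \<omega>) \<in> H"
  using test by (simp add: test_space_def)

lemma indicator_in_H: "A \<in> sets (filt_inf X) \<Longrightarrow> indicat_real A \<in> H"
  using test const_in_H[of 1] unfolding test_space_def by fastforce

lemma sum_in_H: "finite I \<Longrightarrow> (\<And>i. i \<in> I \<Longrightarrow> f i \<in> H) \<Longrightarrow> (\<lambda>\<omega>. \<Sum>i\<in>I. f i \<omega>) \<in> H"
  by (induction I rule: finite_induct) (auto intro: const_in_H add_in_H)

text \<open>Finite range makes \<open>f\<close> a finite combination of indicators. This keeps the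
  integrands inside \<open>H\<close>, where \<open>E_ext\<close> is \<open>E\<close> itself.\<close>

lemma history_det_in_H:
  fixes f :: "'w \<Rightarrow> real"
  assumes "history_det X t f"
  shows "f \<in> H"
proof -
  have fin: "finite (range f)"
    using basis assms by (rule finite_range_history_det)
  have "{\<omega>. f \<omega> = v} \<in> sets (filt_inf X)" for v
    using assms by (intro sets_filt_subset_filt_inf) (auto simp: sets_filt_iff[OF basis] history_det_def)
  then have "(\<lambda>\<omega>. \<Sum>v\<in>range f. v * indicat_real {\<omega>. f \<omega> = v} \<omega>) \<in> H"
    by (intro sum_in_H fin scale_in_H indicator_in_H)
  also have "(\<lambda>\<omega>. \<Sum>v\<in>range f. v * indicat_real {\<omega>. f \<omega> = v} \<omega>) = f"
  proof
    fix \<omega>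
    have "(\<Sum>v\<in>range f. v * indicat_real {\<omega>. f \<omega> = v} \<omega>) = (\<Sum>v\<in>range f. if v = f \<omega> then v else 0)"
      by (rule sum.cong) (auto simp: indicator_def)
    then show "(\<Sum>v\<in>range f. v * indicat_real {\<omega>. f \<omega> = v} \<omega>) = f \<omega>"
      using fin by simp
  qed
  finally show ?thesis .
qed

lemma E_mono: "f \<in> H \<Longrightarrow> g \<in> H \<Longrightarrow> (\<And>\<omega>. g \<omega> \<le> f \<omega>) \<Longrightarrow> E t g \<omega> \<le> E t f \<omega>"
proof -
  have "\<forall>t. \<forall>f\<in>H. \<forall>g\<in>H. (\<forall>\<omega>. g \<omega> \<le> f \<omega>) \<longrightarrow> (\<forall>\<omega>. E t g \<omega> \<le> E t f \<omega>)"
    using SL by (simp add: SL_expectation_def)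
  then show "f \<in> H \<Longrightarrow> g \<in> H \<Longrightarrow> (\<And>\<omega>. g \<omega> \<le> f \<omega>) \<Longrightarrow> E t g \<omega> \<le> E t f \<omega>"
    by blast
qed

lemma E_add: "f \<in> H \<Longrightarrow> g \<in> H \<Longrightarrow> E t (\<lambda>\<omega>. f \<omega> + g \<omega>) \<omega> \<le> E t f \<omega> + E t g \<omega>"
  using SL unfolding SL_expectation_def by blast

lemma E_indicator:
  "A \<in> sets (filt X t) \<Longrightarrow> f \<in> H \<Longrightarrow>
    E t (\<lambda>\<omega>. indicat_real A \<omega> * f \<omega>) = (\<lambda>\<omega>. indicat_real A \<omega> * E t f \<omega>)"
  using SL unfolding SL_expectation_def by blast

lemma E_zero: "E t (\<lambda>_. 0) = (\<lambda>_. 0)"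
proof -
  have "E t (\<lambda>\<omega>. indicat_real {} \<omega> * 0) = (\<lambda>\<omega>. indicat_real {} \<omega> * E t (\<lambda>_. 0) \<omega>)"
    by (rule E_indicator) (auto intro: const_in_H)
  then show ?thesis
    by simp
qed

lemma history_det_E: "f \<in> H \<Longrightarrow> history_det X t (E t f)"
  using SL unfolding SL_expectation_def test_space_at_def
  by (metis (no_types, lifting) IntE borel_measurable_filt_iff[OF basis])

text \<open>After multiplication by the indicator of \<open>A\<close> the two functions coincide,
  and the indicator can be pulled out of \<open>E t\<close>. Taking an atom for \<open>A\<close>
  localises \<open>E t\<close> to single histories.\<close>

lemma E_local:
  assumes "A \<in> sets (filt X t)" "f \<in> H" "g \<in> H" "\<omega> \<in> A" "\<And>\<omega>'. \<omega>' \<in> A \<Longrightarrow> f \<omega>' = g \<omega>'"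
  shows "E t f \<omega> = E t g \<omega>"
proof -
  have "(\<lambda>\<omega>. indicat_real A \<omega> * f \<omega>) = (\<lambda>\<omega>. indicat_real A \<omega> * g \<omega>)"
    using assms(5) by (auto simp: indicator_def)
  then have "(\<lambda>\<omega>. indicat_real A \<omega> * E t f \<omega>) = (\<lambda>\<omega>. indicat_real A \<omega> * E t g \<omega>)"
    by (simp only: E_indicator[OF assms(1,2), symmetric] E_indicator[OF assms(1,3), symmetric])
  from fun_cong[OF this, of \<omega>] assms(4) show ?thesis
    by simp
qed

section \<open>Null events and quasi-sure statements\<close>

lemma null_event_empty: "null_event X E {}"
proof -
  have "indicat_real ({} :: 'w set) = (\<lambda>_. 0)"
    by auto
  then show ?thesis
    using E_zero by (simp add: null_event_def)
qed

text \<open>Monotonicity squeezes the value between those of the zero function and of the indicator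
  of \<open>B\<close>.\<close>

lemma null_event_subset:
  assumes "null_event X E B" "A \<subseteq> B" "A \<in> sets (filt_inf X)"
  shows "null_event X E A"
proof -
  have B: "B \<in> sets (filt_inf X)" "E 0 (indicat_real B) = (\<lambda>_. 0)"
    using assms(1) by (auto simp: null_event_def)
  have "E 0 (indicat_real A) \<omega> = 0" for \<omega>
  proof (rule antisym)
    have "E 0 (indicat_real A) \<omega> \<le> E 0 (indicat_real B) \<omega>"
      using assms(2) by (intro E_mono indicator_in_H assms(3) B(1)) (auto simp: indicator_def)
    then show "E 0 (indicat_real A) \<omega> \<le> 0"
      by (simp add: B(2))
    have "E 0 (\<lambda>_. 0) \<omega> \<le> E 0 (indicat_real A) \<omega>"
      by (intro E_mono indicator_in_H assms(3) const_in_H) auto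
    then show "0 \<le> E 0 (indicat_real A) \<omega>"
      by (simp add: E_zero)
  qed
  then show ?thesis
    using assms(3) by (auto simp: null_event_def)
qed

text \<open>The indicator of a union is at most the sum of the indicators, and \<open>E 0\<close> is
  subadditive.\<close>

lemma null_event_Un:
  assumes "null_event X E A" "null_event X E B"
  shows "null_event X E (A \<union> B)"
proof -
  have A: "A \<in> sets (filt_inf X)" "E 0 (indicat_real A) = (\<lambda>_. 0)"
    and B: "B \<in> sets (filt_inf X)" "E 0 (indicat_real B) = (\<lambda>_. 0)"
    using assms by (auto simp: null_event_def)
  have AB: "A \<union> B \<in> sets (filt_inf X)"
    using A(1) B(1) by simp
  have "E 0 (indicat_real (A \<union> B)) \<omega> = 0" for \<omega>
  proof (rule antisym)
    have "E 0 (indicat_real (A \<union> B)) \<omega> \<le> E 0 (\<lambda>\<omega>. indicat_real A \<omega> + indicat_real B \<omega>) \<omega>"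
      by (intro E_mono indicator_in_H add_in_H A(1) B(1) AB) (auto simp: indicator_def)
    also have "\<dots> \<le> E 0 (indicat_real A) \<omega> + E 0 (indicat_real B) \<omega>"
      by (intro E_add indicator_in_H A(1) B(1))
    finally show "E 0 (indicat_real (A \<union> B)) \<omega> \<le> 0"
      by (simp add: A(2) B(2))
    have "E 0 (\<lambda>_. 0) \<omega> \<le> E 0 (indicat_real (A \<union> B)) \<omega>"
      by (intro E_mono indicator_in_H AB const_in_H) auto
    then show "0 \<le> E 0 (indicat_real (A \<union> B)) \<omega>"
      by (simp add: E_zero)
  qed
  then show ?thesis
    using AB by (auto simp: null_event_def)
qed

lemma null_event_Union:
  "finite \<A> \<Longrightarrow> (\<And>A. A \<in> \<A> \<Longrightarrow> null_event X E A) \<Longrightarrow> null_event X E (\<Union>\<A>)"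
  by (induction \<A> rule: finite_induct) (auto intro: null_event_empty null_event_Un)

lemma quasi_surely_all: "(\<And>\<omega>. P \<omega>) \<Longrightarrow> quasi_surely X E P"
  using null_event_empty by (auto simp: quasi_surely_def)

lemma quasi_surely_mono: "quasi_surely X E P \<Longrightarrow> (\<And>\<omega>. P \<omega> \<Longrightarrow> R \<omega>) \<Longrightarrow> quasi_surely X E R"
  by (auto simp: quasi_surely_def)

lemma quasi_surely_conj:
  assumes "quasi_surely X E P" "quasi_surely X E R"
  shows "quasi_surely X E (\<lambda>\<omega>. P \<omega> \<and> R \<omega>)"
  using assms null_event_Un unfolding quasi_surely_def by (metis UnCI)

text \<open>If \<open>P\<close> failed on all of \<open>A\<close>, then \<open>A\<close> would lie
  in the exceptional null event. This turns a quasi-sure statement into one at a point of a given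
  non-null atom.\<close>

lemma quasi_surely_obtain:
  assumes "quasi_surely X E P" "A \<in> sets (filt_inf X)" "\<not> null_event X E A"
  obtains \<omega> where "\<omega> \<in> A" "P \<omega>"
  using assms null_event_subset unfolding quasi_surely_def by (metis subsetI)

text \<open>There are finitely many atoms, so the null ones together form a null event, which serves
  as the exceptional set.\<close>

lemma quasi_surely_atomwise:
  assumes "\<And>\<omega>. \<not> null_event X E {\<omega>'. same_history X t \<omega> \<omega>'} \<Longrightarrow> P \<omega>"
  shows "quasi_surely X E P"
proof -
  define \<A> where "\<A> = {A \<in> range (\<lambda>\<omega>. {\<omega>'. same_history X t \<omega> \<omega>'}). null_event X E A}"
  have "history_det X t (\<lambda>\<omega>. {\<omega>'. same_history X t \<omega> \<omega>'})"
    unfolding history_det_def by (blast intro: same_history_sym same_history_trans)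
  then have "finite \<A>"
    unfolding \<A>_def using finite_range_history_det[OF basis]
    by (intro finite_subset[OF Collect_restrict]) blast
  then have "null_event X E (\<Union>\<A>)"
    by (rule null_event_Union) (simp add: \<A>_def)
  moreover have "P \<omega>" if "\<omega> \<notin> \<Union>\<A>" for \<omega>
    using that same_history_refl by (intro assms) (auto simp: \<A>_def)
  ultimately show ?thesis
    by (auto simp: quasi_surely_def)
qed

end


section \<open>Coordinates with respect to a stacked matrix\<close>

text \<open>The block matrix [a | Z | Z'], shaped to stand to the left of
  \<open>stacked\<close>.\<close>

definition joined :: "nat \<Rightarrow> nat \<Rightarrow> real vec \<Rightarrow> real mat \<Rightarrow> real mat \<Rightarrow> real mat" where
  "joined N M a Z Z' = mat (dim_vec a) N (\<lambda>(i, j).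
     if j = 0 then a $ i else if j \<le> M then Z $$ (i, j - 1) else Z' $$ (i, j - 1 - M))"

lemma joined_surj:
  assumes "M < N" "D \<in> carrier_mat K N"
  obtains a Z Z' where "a \<in> carrier_vec K" "Z \<in> carrier_mat K M" "Z' \<in> carrier_mat K (N - M - 1)"
    "joined N M a Z Z' = D"
proof
  show "joined N M (vec K (\<lambda>i. D $$ (i, 0))) (mat K M (\<lambda>(i, j). D $$ (i, Suc j)))
      (mat K (N - M - 1) (\<lambda>(i, j). D $$ (i, Suc (M + j)))) = D"
    using assms by (intro eq_matI) (auto simp: joined_def)
qed auto

text \<open>The blocks are read off at the columns \<open>0\<close>, \<open>Suc j\<close> and
  \<open>Suc (M + j)\<close>.\<close>

lemma joined_inject:
  assumes "M < N"
    and "a \<in> carrier_vec K" "Z \<in> carrier_mat K M" "Z' \<in> carrier_mat K (N - M - 1)"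
    and "b \<in> carrier_vec K" "W \<in> carrier_mat K M" "W' \<in> carrier_mat K (N - M - 1)"
    and eq: "joined N M a Z Z' = joined N M b W W'"
  shows "a = b \<and> Z = W \<and> Z' = W'"
proof -
  have e: "joined N M a Z Z' $$ (i, j) = joined N M b W W' $$ (i, j)" for i j
    by (simp add: eq)
  have "a = b"
  proof (rule eq_vecI)
    fix i assume "i < dim_vec b"
    then show "a $ i = b $ i"
      using assms(1-7) e[of i 0] by (auto simp: joined_def)
  qed (use assms in auto)
  moreover have "Z = W"
  proof (rule eq_matI)
    fix i j assume "i < dim_row W" "j < dim_col W"
    then show "Z $$ (i, j) = W $$ (i, j)"
      using assms(1-7) e[of i "Suc j"] by (auto simp: joined_def)
  qed (use assms in auto)
  moreover have "Z' = W'"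
  proof (rule eq_matI)
    fix i j assume "i < dim_row W'" "j < dim_col W'"
    then show "Z' $$ (i, j) = W' $$ (i, j)"
      using assms(1-7) e[of i "Suc (M + j)"] by (auto simp: joined_def)
  qed (use assms in auto)
  ultimately show ?thesis
    by simp
qed

lemma stacked_carrier:
  assumes "M < N" "A \<in> carrier_mat M N" "B \<in> carrier_mat (N - M - 1) N"
  shows "stacked N A B \<in> carrier_mat N N"
  using assms by (auto simp: stacked_def)

lemma stacked_index:
  assumes "M < N" "A \<in> carrier_mat M N" "B \<in> carrier_mat (N - M - 1) N" "i < N" "j < N"
  shows "stacked N A B $$ (i, j) =
    (if i = 0 then 1 else if i \<le> M then A $$ (i - 1, j) else B $$ (i - 1 - M, j))"
  using assms by (cases i) (auto simp: stacked_def mat_of_rows_def nth_append)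

text \<open>Block multiplication gives a 1 + Z A + Z' B, where 1 is the row of ones; this is why
  \<open>a\<close> enters every column unchanged.\<close>

lemma col_joined_mult_stacked:
  assumes "M < N" "A \<in> carrier_mat M N" "B \<in> carrier_mat (N - M - 1) N"
    and "a \<in> carrier_vec K" "Z \<in> carrier_mat K M" "Z' \<in> carrier_mat K (N - M - 1)"
    and "j < N"
  shows "col (joined N M a Z Z' * stacked N A B) j =
    a + Z *\<^sub>v (A *\<^sub>v unit_vec N j) + Z' *\<^sub>v (B *\<^sub>v unit_vec N j)"
proof (rule eq_vecI)
  let ?S = "stacked N A B" and ?D = "joined N M a Z Z'"
  have S: "?S \<in> carrier_mat N N"
    using assms by (intro stacked_carrier)
  have D: "?D \<in> carrier_mat K N"
    using assms by (simp add: joined_def)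
  show "dim_vec (col (?D * ?S) j) = dim_vec (a + Z *\<^sub>v (A *\<^sub>v unit_vec N j) + Z' *\<^sub>v (B *\<^sub>v unit_vec N j))"
    using assms D by simp
  fix i assume "i < dim_vec (a + Z *\<^sub>v (A *\<^sub>v unit_vec N j) + Z' *\<^sub>v (B *\<^sub>v unit_vec N j))"
  then have i: "i < K"
    using assms by simp
  \<comment> \<open>With \<open>N = Suc (M + P)\<close> the sum over \<open>N\<close> indices splits
    into the three blocks without truncated subtraction.\<close>
  define P where "P = N - M - 1"
  have N: "N = Suc (M + P)"
    using assms(1) by (simp add: P_def)
  have split: "(\<Sum>k<M + P. g k) = (\<Sum>k<M. g k) + (\<Sum>k<P. g (M + k))" for g :: "nat \<Rightarrow> real"
    by (induction P) (simp_all add: add.assoc)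
  have "col (?D * ?S) j $ i = (\<Sum>k<N. ?D $$ (i, k) * ?S $$ (k, j))"
    using S D i \<open>j < N\<close> by (auto simp: scalar_prod_def atLeast0LessThan intro!: sum.cong)
  also have "\<dots> = ?D $$ (i, 0) * ?S $$ (0, j) + (\<Sum>k<M. ?D $$ (i, Suc k) * ?S $$ (Suc k, j))
      + (\<Sum>k<P. ?D $$ (i, Suc (M + k)) * ?S $$ (Suc (M + k), j))"
    unfolding N sum.lessThan_Suc_shift split by simp
  also have "\<dots> = a $ i + (\<Sum>k<M. Z $$ (i, k) * A $$ (k, j)) + (\<Sum>k<P. Z' $$ (i, k) * B $$ (k, j))"
    using assms i by (auto simp: stacked_index joined_def P_def)
  also have "\<dots> = (a + Z *\<^sub>v (A *\<^sub>v unit_vec N j) + Z' *\<^sub>v (B *\<^sub>v unit_vec N j)) $ i"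
    using assms i by (auto simp: scalar_prod_def atLeast0LessThan P_def mult_delta_right)
  finally show "col (?D * ?S) j $ i = (a + Z *\<^sub>v (A *\<^sub>v unit_vec N j) + Z' *\<^sub>v (B *\<^sub>v unit_vec N j)) $ i" .
qed

text \<open>A left inverse \<open>S'\<close> of the stacked matrix gives the coefficients as the
  blocks of \<open>C * S'\<close>.\<close>

lemma stacked_representation:
  assumes "M < N" and "A \<in> carrier_mat M N" "B \<in> carrier_mat (N - M - 1) N"
    and inv: "invertible_mat (stacked N A B)" and C: "C \<in> carrier_mat K N"
  obtains a Z Z' where "a \<in> carrier_vec K" "Z \<in> carrier_mat K M" "Z' \<in> carrier_mat K (N - M - 1)"
    "\<And>j. j < N \<Longrightarrow> col C j = a + Z *\<^sub>v (A *\<^sub>v unit_vec N j) + Z' *\<^sub>v (B *\<^sub>v unit_vec N j)"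
proof -
  obtain S' where S': "S' \<in> carrier_mat N N" "S' * stacked N A B = 1\<^sub>m N"
    using inv stacked_carrier[OF assms(1-3)] unfolding invertible_mat_def inverts_mat_def
    by (metis carrier_matD carrier_matI index_mult_mat(2,3) index_one_mat(2,3))
  obtain a Z Z' where D: "a \<in> carrier_vec K" "Z \<in> carrier_mat K M" "Z' \<in> carrier_mat K (N - M - 1)"
    "joined N M a Z Z' = C * S'"
    using joined_surj[OF assms(1) mult_carrier_mat[OF C S'(1)]] .
  have "joined N M a Z Z' * stacked N A B = C"
    unfolding D(4) using S' C stacked_carrier[OF assms(1-3)]
    by (simp add: assoc_mult_mat[of _ K N _ N _ N])
  then show thesis
    using that[OF D(1-3)] col_joined_mult_stacked[OF assms(1-3) D(1-3)] by metis
qed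

text \<open>Agreement on all unit vectors makes the two products with the stacked matrix equal
  column by column; a right inverse then cancels that matrix.\<close>

lemma stacked_representation_unique:
  assumes "M < N" and "A \<in> carrier_mat M N" "B \<in> carrier_mat (N - M - 1) N"
    and inv: "invertible_mat (stacked N A B)"
    and a: "a \<in> carrier_vec K" "Z \<in> carrier_mat K M" "Z' \<in> carrier_mat K (N - M - 1)"
    and b: "b \<in> carrier_vec K" "W \<in> carrier_mat K M" "W' \<in> carrier_mat K (N - M - 1)"
    and eq: "\<And>j. j < N \<Longrightarrow>
      a + Z *\<^sub>v (A *\<^sub>v unit_vec N j) + Z' *\<^sub>v (B *\<^sub>v unit_vec N j) =
      b + W *\<^sub>v (A *\<^sub>v unit_vec N j) + W' *\<^sub>v (B *\<^sub>v unit_vec N j)"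
  shows "a = b \<and> Z = W \<and> Z' = W'"
proof (rule joined_inject[OF assms(1) a b])
  let ?S = "stacked N A B"
  have S: "?S \<in> carrier_mat N N"
    by (rule stacked_carrier[OF assms(1-3)])
  have D: "joined N M a Z Z' \<in> carrier_mat K N" "joined N M b W W' \<in> carrier_mat K N"
    using a b by (auto simp: joined_def)
  obtain S' where S': "S' \<in> carrier_mat N N" "?S * S' = 1\<^sub>m N"
    using inv S unfolding invertible_mat_def inverts_mat_def
    by (metis carrier_matD carrier_matI index_mult_mat(2,3) index_one_mat(2,3))
  have "col (joined N M a Z Z' * ?S) j = col (joined N M b W W' * ?S) j" if "j < N" for j
    using that eq
    by (simp only: col_joined_mult_stacked[OF assms(1-3) a] col_joined_mult_stacked[OF assms(1-3) b])
  then have "joined N M a Z Z' * ?S = joined N M b W W' * ?S"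
    by (rule mat_col_eqI) (use D S in auto)
  then have "joined N M a Z Z' * (?S * S') = joined N M b W W' * (?S * S')"
    by (simp only: assoc_mult_mat[OF D(1) S S'(1), symmetric] assoc_mult_mat[OF D(2) S S'(1), symmetric])
  then show "joined N M a Z Z' = joined N M b W W'"
    using D by (simp add: S'(2))
qed


section \<open>One step of the equation\<close>

locale bsde_setting = sublinear_setting N X H E
  for N and X :: "nat \<Rightarrow> 'w \<Rightarrow> real vec" and H E +
  fixes M K :: nat
    and \<phi>s \<phi>' :: "nat \<Rightarrow> 'w \<Rightarrow> real mat"
  assumes M_less: "M < N"
    and change: "basis_change N M X H E \<phi>s \<phi>'"
begin

lemma phi_carrier: "\<phi>s t \<omega> \<in> carrier_mat M N" "\<phi>' t \<omega> \<in> carrier_mat (N - M - 1) N"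
  and phi_det: "history_det X t (\<phi>s t)" "history_det X t (\<phi>' t)"
  and phi_invertible: "invertible_mat (stacked N (\<phi>s t \<omega>) (\<phi>' t \<omega>))"
  using change by (auto simp: basis_change_def adapted_mat_iff[OF basis])

lemma next_unit_vec:
  obtains j where "j < N" "X (Suc t) \<omega> = unit_vec N j"
  using basis unfolding basis_process_def by (metis le_add1 plus_1_eq_Suc)

text \<open>The increment involves \<open>X (Suc t)\<close>, so the integrand depends on the history
  up to \<open>Suc t\<close>, one step beyond \<open>z\<close>.\<close>

lemma integrand_in_H:
  assumes "history_det X t z"
  shows "(\<lambda>\<omega>. (z \<omega> *\<^sub>v incr N X \<phi>' t \<omega>) $ i) \<in> H"
proof (rule history_det_in_H[of "Suc t"])
  show "history_det X (Suc t) (\<lambda>\<omega>. (z \<omega> *\<^sub>v incr N X \<phi>' t \<omega>) $ i)"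
    using assms phi_det(2)[of t] unfolding history_det_def incr_eq[OF basis] same_history_Suc
    by metis
qed

text \<open>The integrand lies in \<open>H\<close>, so \<open>E_ext\<close> takes its first branch
  and no version has to be chosen.\<close>

lemma G_map_eq:
  assumes "history_det X t z"
  shows "G_map K N X H E \<phi>' t z \<omega> = vec K (\<lambda>i. E t (\<lambda>\<omega>. (z \<omega> *\<^sub>v incr N X \<phi>' t \<omega>) $ i) \<omega>)"
  using integrand_in_H[OF assms] by (simp add: G_map_def E_ext_def)

lemma G_map_carrier: "G_map K N X H E \<phi>' t z \<omega> \<in> carrier_vec K"
  by (simp add: G_map_def)

lemma history_det_G_map:
  assumes "history_det X t z"
  shows "history_det X t (G_map K N X H E \<phi>' t z)"
  unfolding history_det_def G_map_eq[OF assms]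
  using history_detD[OF history_det_E[OF integrand_in_H[OF assms]]] by auto

text \<open>\<open>G_map\<close> takes a whole random matrix, but only the value at
  \<open>\<omega>\<close> matters: \<open>z\<close> and \<open>w\<close> then agree on the atom of
  \<open>\<omega>\<close>, and \<open>E_local\<close> applies.\<close>

lemma G_map_local:
  assumes "history_det X t z" "history_det X t w" "z \<omega> = w \<omega>"
  shows "G_map K N X H E \<phi>' t z \<omega> = G_map K N X H E \<phi>' t w \<omega>"
proof -
  have "z \<omega>' = w \<omega>'" if "same_history X t \<omega> \<omega>'" for \<omega>'
    using that assms history_detD by metis
  then show ?thesis
    unfolding G_map_eq[OF assms(1)] G_map_eq[OF assms(2)]
    by (intro arg_cong[where f = "vec K"] ext
        E_local[OF atom_in_sets_filt[of _ _ \<omega>] integrand_in_H[OF assms(1)] integrand_in_H[OF assms(2)]]) auto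
qed

text \<open>On one atom at time \<open>t\<close>, \<open>V\<close> is a function of the next state
  alone, hence given by the columns of a matrix, to which \<open>stacked_representation\<close>
  applies.\<close>

lemma one_step_representation:
  assumes V: "history_det X (Suc t) V" "\<And>\<omega>. V \<omega> \<in> carrier_vec K"
  obtains a Z Z' where "history_det X t a" "\<And>\<omega>. a \<omega> \<in> carrier_vec K"
    "history_det X t Z" "\<And>\<omega>. Z \<omega> \<in> carrier_mat K M"
    "history_det X t Z'" "\<And>\<omega>. Z' \<omega> \<in> carrier_mat K (N - M - 1)"
    "\<And>\<omega>. V \<omega> = a \<omega> + Z \<omega> *\<^sub>v incr N X \<phi>s t \<omega> + Z' \<omega> *\<^sub>v incr N X \<phi>' t \<omega>"
proof -
  \<comment> \<open>The identity is required on the whole atom of \<open>\<omega>\<close>, so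
    \<open>P\<close> depends only on the atom and \<open>history_det_choice\<close> selects all
    three coefficients at once.\<close>
  define P where "P \<omega> = (\<lambda>(a, Z, Z'). a \<in> carrier_vec K \<and> Z \<in> carrier_mat K M \<and>
    Z' \<in> carrier_mat K (N - M - 1) \<and>
    (\<forall>\<omega>'. same_history X t \<omega> \<omega>' \<longrightarrow>
      V \<omega>' = a + Z *\<^sub>v incr N X \<phi>s t \<omega>' + Z' *\<^sub>v incr N X \<phi>' t \<omega>'))" for \<omega>
  have "same_history X t \<omega> = same_history X t \<omega>'" if "same_history X t \<omega> \<omega>'" for \<omega> \<omega>'
    using that by (blast intro: same_history_sym same_history_trans)
  then have "history_det X t P"
    unfolding history_det_def P_def by simp
  moreover have "\<exists>p. P \<omega> p" for \<omega>
  proof -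
    \<comment> \<open>\<open>\<eta> j\<close> continues the history of \<open>\<omega>\<close> with
      state \<open>j\<close>. If there is no such continuation it is arbitrary, and column
      \<open>j\<close> of \<open>C\<close> is then never compared with \<open>V\<close>.\<close>
    define \<eta> where "\<eta> j = (SOME \<omega>'. same_history X t \<omega> \<omega>' \<and> X (Suc t) \<omega>' = unit_vec N j)" for j
    define C where "C = mat K N (\<lambda>(i, j). V (\<eta> j) $ i)"
    have C: "C \<in> carrier_mat K N"
      by (simp add: C_def)
    obtain a Z Z' where *: "a \<in> carrier_vec K" "Z \<in> carrier_mat K M" "Z' \<in> carrier_mat K (N - M - 1)"
      "\<And>j. j < N \<Longrightarrow>
        col C j = a + Z *\<^sub>v (\<phi>s t \<omega> *\<^sub>v unit_vec N j) + Z' *\<^sub>v (\<phi>' t \<omega> *\<^sub>v unit_vec N j)"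
      using stacked_representation[OF M_less phi_carrier[of t \<omega>] phi_invertible C] by blast
    have "V \<omega>' = a + Z *\<^sub>v incr N X \<phi>s t \<omega>' + Z' *\<^sub>v incr N X \<phi>' t \<omega>'"
      if same: "same_history X t \<omega> \<omega>'" for \<omega>'
    proof -
      obtain j where j: "j < N" "X (Suc t) \<omega>' = unit_vec N j"
        by (rule next_unit_vec)
      have "same_history X t \<omega> (\<eta> j) \<and> X (Suc t) (\<eta> j) = unit_vec N j"
        unfolding \<eta>_def by (rule someI[of _ \<omega>']) (use same j in auto)
      then have "same_history X (Suc t) \<omega>' (\<eta> j)"
        using same j by (auto simp: same_history_Suc intro: same_history_trans same_history_sym)
      then have "V \<omega>' = V (\<eta> j)"
        by (rule history_detD[OF V(1)])
      also have "\<dots> = col C j"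
        using V(2)[of "\<eta> j"] j(1) by (intro eq_vecI) (auto simp: C_def)
      finally show ?thesis
        using *(4)[OF j(1)] j(2) history_detD[OF phi_det(1) same] history_detD[OF phi_det(2) same]
        by (simp add: incr_eq[OF basis])
    qed
    then have "P \<omega> (a, Z, Z')"
      using * by (simp add: P_def)
    then show ?thesis ..
  qed
  ultimately obtain f where f: "history_det X t f" "\<And>\<omega>. P \<omega> (f \<omega>)"
    by (metis history_det_choice)
  show thesis
  proof
    show "history_det X t (\<lambda>\<omega>. fst (f \<omega>))" "history_det X t (\<lambda>\<omega>. fst (snd (f \<omega>)))"
      "history_det X t (\<lambda>\<omega>. snd (snd (f \<omega>)))"
      using f(1) by (simp_all add: history_det_def)
  qed (use f(2) in \<open>auto simp: P_def case_prod_beta\<close>)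
qed

end

section \<open>Solving a single time step, with existence and uniqueness\<close>

definition regular_driver ::
  "(nat \<Rightarrow> 'w \<Rightarrow> real vec) \<Rightarrow> (nat \<Rightarrow> ('w \<Rightarrow> real) \<Rightarrow> 'w \<Rightarrow> real) \<Rightarrow> nat \<Rightarrow> nat \<Rightarrow> nat \<Rightarrow>
   nat \<Rightarrow> ('w \<Rightarrow> nat \<Rightarrow> real vec \<Rightarrow> real mat \<Rightarrow> real mat \<Rightarrow> real vec) \<Rightarrow> bool" where
  "regular_driver X E K M P t F \<longleftrightarrow>
     (\<forall>z\<in>carrier_mat K M. \<forall>z'\<in>carrier_mat K P.
        (\<forall>y\<in>carrier_vec K. (\<forall>\<omega>. F \<omega> t y z z' \<in> carrier_vec K) \<and>
           history_det X t (\<lambda>\<omega>. F \<omega> t y z z')) \<and>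
        quasi_surely X E
          (\<lambda>\<omega>. bij_betw (\<lambda>y. y - F \<omega> t y z z') (carrier_vec K) (carrier_vec K)))"

context bsde_setting
begin

text \<open>The exceptional set in \<open>regular_driver\<close> may depend on \<open>z\<close> and
  \<open>z'\<close>. A non-null atom has a point outside it, and \<open>F\<close> is constant along
  the atom, so every point of the atom is good for all \<open>z\<close> and \<open>z'\<close>, in
  particular for the values of random integrands.\<close>

lemma driver_bij:
  assumes F: "regular_driver X E K M (N - M - 1) t F"
    and "z \<in> carrier_mat K M" "z' \<in> carrier_mat K (N - M - 1)"
    and nonnull: "\<not> null_event X E {\<omega>'. same_history X t \<omega> \<omega>'}"
  shows "bij_betw (\<lambda>y. y - F \<omega> t y z z') (carrier_vec K) (carrier_vec K)"
proof -
  obtain \<omega>' where \<omega>': "same_history X t \<omega> \<omega>'"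
    "bij_betw (\<lambda>y. y - F \<omega>' t y z z') (carrier_vec K) (carrier_vec K)"
    using F assms(2,3) sets_filt_subset_filt_inf[OF atom_in_sets_filt] nonnull
    unfolding regular_driver_def by (metis (no_types, lifting) mem_Collect_eq quasi_surely_obtain)
  have "F \<omega> t y z z' = F \<omega>' t y z z'" if "y \<in> carrier_vec K" for y
    using F assms(2,3) that \<omega>'(1) unfolding regular_driver_def history_det_def by blast
  then show ?thesis
    using \<omega>'(2) by (simp cong: bij_betw_cong)
qed

lemma BSDE_step_exists:
  assumes F: "regular_driver X E K M (N - M - 1) t F"
    and V: "history_det X (Suc t) V" "\<And>\<omega>. V \<omega> \<in> carrier_vec K"
  obtains Y Z Z' where "history_det X t Y" "\<And>\<omega>. Y \<omega> \<in> carrier_vec K"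
    "history_det X t Z" "\<And>\<omega>. Z \<omega> \<in> carrier_mat K M"
    "history_det X t Z'" "\<And>\<omega>. Z' \<omega> \<in> carrier_mat K (N - M - 1)"
    "quasi_surely X E (\<lambda>\<omega>. V \<omega> = Y \<omega> - F \<omega> t (Y \<omega>) (Z \<omega>) (Z' \<omega>)
      + Z \<omega> *\<^sub>v incr N X \<phi>s t \<omega> + Z' \<omega> *\<^sub>v incr N X \<phi>' t \<omega> - G_map K N X H E \<phi>' t Z' \<omega>)"
proof -
  obtain a Z Z' where a: "history_det X t a" "\<And>\<omega>. a \<omega> \<in> carrier_vec K"
    and Z: "history_det X t Z" "\<And>\<omega>. Z \<omega> \<in> carrier_mat K M"
    and Z': "history_det X t Z'" "\<And>\<omega>. Z' \<omega> \<in> carrier_mat K (N - M - 1)"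
    and V_eq: "\<And>\<omega>. V \<omega> = a \<omega> + Z \<omega> *\<^sub>v incr N X \<phi>s t \<omega> + Z' \<omega> *\<^sub>v incr N X \<phi>' t \<omega>"
    using one_step_representation[OF V] by blast
  let ?G = "G_map K N X H E \<phi>' t Z'"
  \<comment> \<open>Comparing the representation of \<open>V\<close> with the equation cancels the
    increments and leaves this equation for \<open>y\<close>.\<close>
  define R where "R \<omega> y \<longleftrightarrow> y \<in> carrier_vec K \<and> y - F \<omega> t y (Z \<omega>) (Z' \<omega>) = a \<omega> + ?G \<omega>" for \<omega> y
  have R_det: "history_det X t R"
    unfolding history_det_def
  proof (intro allI impI ext)
    fix \<omega> \<omega>' y assume same: "same_history X t \<omega> \<omega>'"
    have "F \<omega> t y (Z \<omega>) (Z' \<omega>) = F \<omega>' t y (Z \<omega>) (Z' \<omega>)" if "y \<in> carrier_vec K"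
      using F Z(2) Z'(2) that same unfolding regular_driver_def history_det_def by blast
    then show "R \<omega> y = R \<omega>' y"
      using history_detD[OF a(1) same] history_detD[OF Z(1) same] history_detD[OF Z'(1) same]
        history_detD[OF history_det_G_map[OF Z'(1)] same]
      by (auto simp: R_def)
  qed
  \<comment> \<open>On null atoms \<open>R\<close> may have no solution; the default
    \<open>0\<^sub>v K\<close> keeps \<open>Y\<close> total, adapted and of the right
    dimension.\<close>
  define R' where "R' \<omega> y \<longleftrightarrow> (if \<exists>y. R \<omega> y then R \<omega> y else y = 0\<^sub>v K)" for \<omega> y
  have "history_det X t R'"
    using R_det unfolding history_det_def R'_def by (intro allI impI ext) metis
  moreover have "\<exists>y. R' \<omega> y" for \<omega>
    by (auto simp: R'_def)
  ultimately obtain Y where Y: "history_det X t Y" "\<And>\<omega>. R' \<omega> (Y \<omega>)"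
    by (metis history_det_choice)
  have Y_carrier: "Y \<omega> \<in> carrier_vec K" for \<omega>
    using Y(2)[of \<omega>] by (auto simp: R'_def R_def split: if_splits)
  have "quasi_surely X E (\<lambda>\<omega>. V \<omega> = Y \<omega> - F \<omega> t (Y \<omega>) (Z \<omega>) (Z' \<omega>)
      + Z \<omega> *\<^sub>v incr N X \<phi>s t \<omega> + Z' \<omega> *\<^sub>v incr N X \<phi>' t \<omega> - ?G \<omega>)"
  proof (rule quasi_surely_atomwise)
    fix \<omega> assume "\<not> null_event X E {\<omega>'. same_history X t \<omega> \<omega>'}"
    then have "bij_betw (\<lambda>y. y - F \<omega> t y (Z \<omega>) (Z' \<omega>)) (carrier_vec K) (carrier_vec K)"
      by (rule driver_bij[OF F Z(2) Z'(2)])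
    moreover have "a \<omega> + ?G \<omega> \<in> carrier_vec K"
      using a(2) G_map_carrier by simp
    \<comment> \<open>Surjectivity provides a solution, so the default does not occur on this
      atom.\<close>
    ultimately have "\<exists>y. R \<omega> y"
      unfolding R_def bij_betw_def image_iff by (metis (no_types, lifting) imageE)
    then have "Y \<omega> - F \<omega> t (Y \<omega>) (Z \<omega>) (Z' \<omega>) = a \<omega> + ?G \<omega>"
      using Y(2)[of \<omega>] by (auto simp: R'_def R_def)
    then show "V \<omega> = Y \<omega> - F \<omega> t (Y \<omega>) (Z \<omega>) (Z' \<omega>)
        + Z \<omega> *\<^sub>v incr N X \<phi>s t \<omega> + Z' \<omega> *\<^sub>v incr N X \<phi>' t \<omega> - ?G \<omega>"
      using a(2)[of \<omega>] Z(2)[of \<omega>] Z'(2)[of \<omega>] G_map_carrier[of t Z' \<omega>]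
      unfolding V_eq by (intro eq_vecI) auto
  qed
  with that Y(1) Z Z' Y_carrier show thesis
    by blast
qed

lemma BSDE_step_unique:
  assumes F: "regular_driver X E K M (N - M - 1) t F"
    and nondeg: "nondegenerate N T X E" "t < T"
    and Y: "history_det X t Y" "\<And>\<omega>. Y \<omega> \<in> carrier_vec K"
    and Z: "history_det X t Z" "\<And>\<omega>. Z \<omega> \<in> carrier_mat K M"
    and Z': "history_det X t Z'" "\<And>\<omega>. Z' \<omega> \<in> carrier_mat K (N - M - 1)"
    and V: "history_det X t V" "\<And>\<omega>. V \<omega> \<in> carrier_vec K"
    and W: "history_det X t W" "\<And>\<omega>. W \<omega> \<in> carrier_mat K M"
    and W': "history_det X t W'" "\<And>\<omega>. W' \<omega> \<in> carrier_mat K (N - M - 1)"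
    and eq: "quasi_surely X E (\<lambda>\<omega>.
      Y \<omega> - F \<omega> t (Y \<omega>) (Z \<omega>) (Z' \<omega>)
        + Z \<omega> *\<^sub>v incr N X \<phi>s t \<omega> + Z' \<omega> *\<^sub>v incr N X \<phi>' t \<omega> - G_map K N X H E \<phi>' t Z' \<omega> =
      V \<omega> - F \<omega> t (V \<omega>) (W \<omega>) (W' \<omega>)
        + W \<omega> *\<^sub>v incr N X \<phi>s t \<omega> + W' \<omega> *\<^sub>v incr N X \<phi>' t \<omega> - G_map K N X H E \<phi>' t W' \<omega>)"
  shows "quasi_surely X E (\<lambda>\<omega>. Y \<omega> = V \<omega> \<and> Z \<omega> = W \<omega> \<and> Z' \<omega> = W' \<omega>)"
proof (rule quasi_surely_atomwise)
  fix \<omega> assume nonnull: "\<not> null_event X E {\<omega>'. same_history X t \<omega> \<omega>'}"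
  let ?GZ = "G_map K N X H E \<phi>' t Z'" and ?GW = "G_map K N X H E \<phi>' t W'"
  \<comment> \<open>\<open>a\<close> and \<open>b\<close> collect the terms that do not involve the
    next state.\<close>
  define a where "a = Y \<omega> - F \<omega> t (Y \<omega>) (Z \<omega>) (Z' \<omega>) - ?GZ \<omega>"
  define b where "b = V \<omega> - F \<omega> t (V \<omega>) (W \<omega>) (W' \<omega>) - ?GW \<omega>"
  have F_carrier: "F \<omega> t (Y \<omega>) (Z \<omega>) (Z' \<omega>) \<in> carrier_vec K" "F \<omega> t (V \<omega>) (W \<omega>) (W' \<omega>) \<in> carrier_vec K"
    using F Y(2) Z(2) Z'(2) V(2) W(2) W'(2) unfolding regular_driver_def by blast+
  have ab: "a \<in> carrier_vec K" "b \<in> carrier_vec K"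
    using F_carrier G_map_carrier Y(2) V(2) by (auto simp: a_def b_def intro!: minus_carrier_vec)
  have "a = b \<and> Z \<omega> = W \<omega> \<and> Z' \<omega> = W' \<omega>"
  proof (rule stacked_representation_unique[OF M_less phi_carrier[of t \<omega>] phi_invertible
        ab(1) Z(2) Z'(2) ab(2) W(2) W'(2)])
    fix j assume "j < N"
    \<comment> \<open>The part of the atom that moves on to state \<open>j\<close>. By nondegeneracy
      it is not null, so the quasi-sure identity holds at some point of it, where all data except
      the next state equal those at \<open>\<omega>\<close>.\<close>
    define B where "B = {\<omega>' \<in> {\<omega>'. same_history X t \<omega> \<omega>'}. X (Suc t) \<omega>' = unit_vec N j}"
    have "\<not> null_event X E {\<omega>' \<in> A. X (Suc t) \<omega>' = unit_vec N j}"
      if "A \<in> sets (filt X t)" "\<not> null_event X E A" for A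
      using that nondeg \<open>j < N\<close> by (simp add: nondegenerate_def)
    then have "\<not> null_event X E B"
      unfolding B_def using atom_in_sets_filt nonnull .
    moreover have "B \<in> sets (filt_inf X)"
      unfolding B_def
      by (intro sets_filt_subset_filt_inf[of _ _ "Suc t"])
        (auto simp: sets_filt_iff[OF basis] history_det_def same_history_def)
    ultimately obtain \<omega>' where \<omega>': "\<omega>' \<in> B" and eq':
      "Y \<omega>' - F \<omega>' t (Y \<omega>') (Z \<omega>') (Z' \<omega>')
        + Z \<omega>' *\<^sub>v incr N X \<phi>s t \<omega>' + Z' \<omega>' *\<^sub>v incr N X \<phi>' t \<omega>' - ?GZ \<omega>' =
      V \<omega>' - F \<omega>' t (V \<omega>') (W \<omega>') (W' \<omega>')
        + W \<omega>' *\<^sub>v incr N X \<phi>s t \<omega>' + W' \<omega>' *\<^sub>v incr N X \<phi>' t \<omega>' - ?GW \<omega>'"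
      using quasi_surely_obtain[OF eq] by metis
    have same: "same_history X t \<omega> \<omega>'" and X: "X (Suc t) \<omega>' = unit_vec N j"
      using \<omega>' by (auto simp: B_def)
    have "F \<omega> t (Y \<omega>) (Z \<omega>) (Z' \<omega>) = F \<omega>' t (Y \<omega>) (Z \<omega>) (Z' \<omega>)"
      "F \<omega> t (V \<omega>) (W \<omega>) (W' \<omega>) = F \<omega>' t (V \<omega>) (W \<omega>) (W' \<omega>)"
      using F Y(2) Z(2) Z'(2) V(2) W(2) W'(2) same unfolding regular_driver_def history_det_def by blast+
    then have eq'': "Y \<omega> - F \<omega> t (Y \<omega>) (Z \<omega>) (Z' \<omega>)
        + Z \<omega> *\<^sub>v (\<phi>s t \<omega> *\<^sub>v unit_vec N j) + Z' \<omega> *\<^sub>v (\<phi>' t \<omega> *\<^sub>v unit_vec N j) - ?GZ \<omega> =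
      V \<omega> - F \<omega> t (V \<omega>) (W \<omega>) (W' \<omega>)
        + W \<omega> *\<^sub>v (\<phi>s t \<omega> *\<^sub>v unit_vec N j) + W' \<omega> *\<^sub>v (\<phi>' t \<omega> *\<^sub>v unit_vec N j) - ?GW \<omega>"
      using eq' X history_detD[OF Y(1) same] history_detD[OF Z(1) same] history_detD[OF Z'(1) same]
        history_detD[OF V(1) same] history_detD[OF W(1) same] history_detD[OF W'(1) same]
        history_detD[OF phi_det(1) same] history_detD[OF phi_det(2) same]
        history_detD[OF history_det_G_map[OF Z'(1)] same]
        history_detD[OF history_det_G_map[OF W'(1)] same]
      by (simp add: incr_eq[OF basis])
    \<comment> \<open>Moves the \<open>G_map\<close> term in front of the increments, as in
      \<open>a\<close> and \<open>b\<close>.\<close>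
    have swap: "u - g + p + q = u + p + q - g"
      if "u \<in> carrier_vec K" "g \<in> carrier_vec K" "p \<in> carrier_vec K" "q \<in> carrier_vec K"
      for u g p q :: "real vec"
      using that by (intro eq_vecI) auto
    show "a + Z \<omega> *\<^sub>v (\<phi>s t \<omega> *\<^sub>v unit_vec N j) + Z' \<omega> *\<^sub>v (\<phi>' t \<omega> *\<^sub>v unit_vec N j) =
        b + W \<omega> *\<^sub>v (\<phi>s t \<omega> *\<^sub>v unit_vec N j) + W' \<omega> *\<^sub>v (\<phi>' t \<omega> *\<^sub>v unit_vec N j)"
      unfolding a_def b_def
      using eq'' Y(2)[of \<omega>] Z(2)[of \<omega>] Z'(2)[of \<omega>] V(2)[of \<omega>] W(2)[of \<omega>] W'(2)[of \<omega>] F_carrier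
        phi_carrier[of t \<omega>] G_map_carrier[of t _ \<omega>]
      by (subst (1 2) swap) (auto intro!: mult_mat_vec_carrier)
  qed
  then have "a = b" and ZW: "Z \<omega> = W \<omega>" "Z' \<omega> = W' \<omega>"
    by auto
  have G: "?GZ \<omega> = ?GW \<omega>"
    by (rule G_map_local[OF Z'(1) W'(1) ZW(2)])
  \<comment> \<open>With equal integrands and equal \<open>G_map\<close> terms,
    \<open>Y \<omega>\<close> and \<open>V \<omega>\<close> have the same image under the bijection
    of the driver, and injectivity identifies them.\<close>
  have "Y \<omega> - F \<omega> t (Y \<omega>) (Z \<omega>) (Z' \<omega>) = a + ?GZ \<omega>"
    using F_carrier Y(2)[of \<omega>] by (intro eq_vecI) (auto simp: a_def G_map_def)
  also have "\<dots> = V \<omega> - F \<omega> t (V \<omega>) (Z \<omega>) (Z' \<omega>)"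
    unfolding \<open>a = b\<close> G using F_carrier V(2)[of \<omega>] ZW
    by (intro eq_vecI) (auto simp: b_def G_map_def)
  finally have "Y \<omega> = V \<omega>"
    using driver_bij[OF F Z(2) Z'(2) nonnull, of \<omega> \<omega>] Y(2) V(2)
    unfolding bij_betw_def by (auto dest: inj_onD)
  with ZW show "Y \<omega> = V \<omega> \<and> Z \<omega> = W \<omega> \<and> Z' \<omega> = W' \<omega>"
    by simp
qed

section \<open>Backward induction over the time steps\<close>

lemma BSDE_solution_iff:
  "BSDE_solution K N M T X H E \<phi>s \<phi>' F Q Y Z Z' \<longleftrightarrow>
    (\<forall>t\<le>T. history_det X t (Y t) \<and> (\<forall>\<omega>. Y t \<omega> \<in> carrier_vec K)) \<and>
    (\<forall>t<T. history_det X t (Z t) \<and> (\<forall>\<omega>. Z t \<omega> \<in> carrier_mat K M) \<and>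
      history_det X t (Z' t) \<and> (\<forall>\<omega>. Z' t \<omega> \<in> carrier_mat K (N - M - 1)) \<and>
      quasi_surely X E (\<lambda>\<omega>. Y (Suc t) \<omega> = Y t \<omega> - F \<omega> t (Y t \<omega>) (Z t \<omega>) (Z' t \<omega>)
        + Z t \<omega> *\<^sub>v incr N X \<phi>s t \<omega> + Z' t \<omega> *\<^sub>v incr N X \<phi>' t \<omega>
        - G_map K N X H E \<phi>' t (Z' t) \<omega>)) \<and>
    quasi_surely X E (\<lambda>\<omega>. Y T \<omega> = Q \<omega>)"
  unfolding BSDE_solution_def adapted_vec_iff[OF basis] adapted_mat_iff[OF basis] by auto

text \<open>Induction on the horizon for arbitrary terminal values: the last step is solved first,
  and its \<open>y\<close> becomes the terminal value of the shorter problem.\<close>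

lemma BSDE_exists:
  assumes "\<And>t. t < T \<Longrightarrow> regular_driver X E K M (N - M - 1) t F"
    and "history_det X T Q" "\<And>\<omega>. Q \<omega> \<in> carrier_vec K"
  shows "\<exists>Y Z Z'. BSDE_solution K N M T X H E \<phi>s \<phi>' F Q Y Z Z'"
  using assms
proof (induction T arbitrary: Q)
  case 0
  \<comment> \<open>\<open>undefined\<close> is harmless here, as the integrands have no times below
    0.\<close>
  then have "BSDE_solution K N M 0 X H E \<phi>s \<phi>' F Q (\<lambda>_. Q) undefined undefined"
    unfolding BSDE_solution_iff by (auto intro: quasi_surely_all)
  then show ?case
    by blast
next
  case (Suc T)
  obtain y z z' where y: "history_det X T y" "\<And>\<omega>. y \<omega> \<in> carrier_vec K"
    and z: "history_det X T z" "\<And>\<omega>. z \<omega> \<in> carrier_mat K M"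
    and z': "history_det X T z'" "\<And>\<omega>. z' \<omega> \<in> carrier_mat K (N - M - 1)"
    and step: "quasi_surely X E (\<lambda>\<omega>. Q \<omega> = y \<omega> - F \<omega> T (y \<omega>) (z \<omega>) (z' \<omega>)
      + z \<omega> *\<^sub>v incr N X \<phi>s T \<omega> + z' \<omega> *\<^sub>v incr N X \<phi>' T \<omega> - G_map K N X H E \<phi>' T z' \<omega>)"
    using BSDE_step_exists[OF Suc.prems(1)[OF lessI] Suc.prems(2,3)] by blast
  obtain Y Z Z' where sol: "BSDE_solution K N M T X H E \<phi>s \<phi>' F y Y Z Z'"
    using Suc.IH[OF _ y] Suc.prems(1) by auto
  \<comment> \<open>At \<open>T\<close> the value is \<open>y\<close> and not \<open>Y T\<close>:
    the two agree only quasi-surely, and the last step was solved with \<open>y\<close>.\<close>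
  define Y1 where "Y1 t = (if t < T then Y t else if t = T then y else Q)" for t
  define Z1 where "Z1 t = (if t < T then Z t else z)" for t
  define Z1' where "Z1' t = (if t < T then Z' t else z')" for t
  have adapted_Y: "history_det X t (Y1 t) \<and> (\<forall>\<omega>. Y1 t \<omega> \<in> carrier_vec K)" if "t \<le> Suc T" for t
    using sol y Suc.prems(2,3) that by (auto simp: BSDE_solution_iff Y1_def le_Suc_eq)
  have adapted_Z: "history_det X t (Z1 t) \<and> (\<forall>\<omega>. Z1 t \<omega> \<in> carrier_mat K M) \<and>
      history_det X t (Z1' t) \<and> (\<forall>\<omega>. Z1' t \<omega> \<in> carrier_mat K (N - M - 1))" if "t < Suc T" for t
    using sol z z' that by (auto simp: BSDE_solution_iff Z1_def Z1'_def less_Suc_eq)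
  have "quasi_surely X E (\<lambda>\<omega>. Y1 (Suc t) \<omega> = Y1 t \<omega> - F \<omega> t (Y1 t \<omega>) (Z1 t \<omega>) (Z1' t \<omega>)
        + Z1 t \<omega> *\<^sub>v incr N X \<phi>s t \<omega> + Z1' t \<omega> *\<^sub>v incr N X \<phi>' t \<omega>
        - G_map K N X H E \<phi>' t (Z1' t) \<omega>)" if "t < Suc T" for t
  proof (cases "t = T")
    case True
    then show ?thesis
      using step by (simp add: Y1_def Z1_def Z1'_def)
  next
    case False
    with that have t: "t < T"
      by simp
    then have "quasi_surely X E (\<lambda>\<omega>. Y (Suc t) \<omega> = Y t \<omega> - F \<omega> t (Y t \<omega>) (Z t \<omega>) (Z' t \<omega>)
        + Z t \<omega> *\<^sub>v incr N X \<phi>s t \<omega> + Z' t \<omega> *\<^sub>v incr N X \<phi>' t \<omega>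
        - G_map K N X H E \<phi>' t (Z' t) \<omega>)"
      and "quasi_surely X E (\<lambda>\<omega>. Y T \<omega> = y \<omega>)"
      using sol by (auto simp: BSDE_solution_iff)
    \<comment> \<open>When \<open>Suc t = T\<close>, the equation of the shorter problem involves
      \<open>Y T\<close>, which equals \<open>y\<close> outside a further null event.\<close>
    from quasi_surely_conj[OF this] show ?thesis
      by (rule quasi_surely_mono) (use t in \<open>auto simp: Y1_def Z1_def Z1'_def less_Suc_eq dest: Suc_lessI\<close>)
  qed
  then have "BSDE_solution K N M (Suc T) X H E \<phi>s \<phi>' F Q Y1 Z1 Z1'"
    using adapted_Y adapted_Z quasi_surely_all unfolding BSDE_solution_iff by (simp add: Y1_def)
  then show ?case
    by blast
qed

lemma BSDE_unique:
  assumes F: "\<And>t. t < T \<Longrightarrow> regular_driver X E K M (N - M - 1) t F"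
    and nondeg: "nondegenerate N T X E"
    and Y: "BSDE_solution K N M T X H E \<phi>s \<phi>' F Q Y Z Z'"
    and V: "BSDE_solution K N M T X H E \<phi>s \<phi>' F Q V W W'"
  shows "t \<le> T \<Longrightarrow> quasi_surely X E (\<lambda>\<omega>. Y t \<omega> = V t \<omega>)"
    and "t < T \<Longrightarrow> quasi_surely X E (\<lambda>\<omega>. Z t \<omega> = W t \<omega> \<and> Z' t \<omega> = W' t \<omega>)"
proof -
  have one_step: "quasi_surely X E (\<lambda>\<omega>. Y t \<omega> = V t \<omega> \<and> Z t \<omega> = W t \<omega> \<and> Z' t \<omega> = W' t \<omega>)"
    if "t < T" and next_eq: "quasi_surely X E (\<lambda>\<omega>. Y (Suc t) \<omega> = V (Suc t) \<omega>)" for t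
  proof (rule BSDE_step_unique[OF F[OF \<open>t < T\<close>] nondeg \<open>t < T\<close>])
    have "quasi_surely X E (\<lambda>\<omega>. Y (Suc t) \<omega> = Y t \<omega> - F \<omega> t (Y t \<omega>) (Z t \<omega>) (Z' t \<omega>)
        + Z t \<omega> *\<^sub>v incr N X \<phi>s t \<omega> + Z' t \<omega> *\<^sub>v incr N X \<phi>' t \<omega>
        - G_map K N X H E \<phi>' t (Z' t) \<omega>)"
      and "quasi_surely X E (\<lambda>\<omega>. V (Suc t) \<omega> = V t \<omega> - F \<omega> t (V t \<omega>) (W t \<omega>) (W' t \<omega>)
        + W t \<omega> *\<^sub>v incr N X \<phi>s t \<omega> + W' t \<omega> *\<^sub>v incr N X \<phi>' t \<omega>
        - G_map K N X H E \<phi>' t (W' t) \<omega>)"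
      using Y V \<open>t < T\<close> by (auto simp: BSDE_solution_iff)
    \<comment> \<open>Equality at \<open>Suc t\<close> equates the two right-hand sides, which is
      the premise of \<open>BSDE_step_unique\<close>.\<close>
    from quasi_surely_conj[OF quasi_surely_conj[OF this] next_eq]
    show "quasi_surely X E (\<lambda>\<omega>. Y t \<omega> - F \<omega> t (Y t \<omega>) (Z t \<omega>) (Z' t \<omega>)
        + Z t \<omega> *\<^sub>v incr N X \<phi>s t \<omega> + Z' t \<omega> *\<^sub>v incr N X \<phi>' t \<omega>
        - G_map K N X H E \<phi>' t (Z' t) \<omega> =
      V t \<omega> - F \<omega> t (V t \<omega>) (W t \<omega>) (W' t \<omega>)
        + W t \<omega> *\<^sub>v incr N X \<phi>s t \<omega> + W' t \<omega> *\<^sub>v incr N X \<phi>' t \<omega>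
        - G_map K N X H E \<phi>' t (W' t) \<omega>)"
      by (rule quasi_surely_mono) auto
  qed (use Y V \<open>t < T\<close> in \<open>auto simp: BSDE_solution_iff\<close>)
  have YV: "quasi_surely X E (\<lambda>\<omega>. Y t \<omega> = V t \<omega>)" if "t \<le> T" for t
    using that
  \<comment> \<open>\<open>inc_induct\<close> descends from \<open>T\<close>, where both solutions
    equal \<open>Q\<close>.\<close>
  proof (induction rule: inc_induct)
    case base
    have "quasi_surely X E (\<lambda>\<omega>. Y T \<omega> = Q \<omega>)" "quasi_surely X E (\<lambda>\<omega>. V T \<omega> = Q \<omega>)"
      using Y V by (auto simp: BSDE_solution_iff)
    from quasi_surely_conj[OF this] show ?case
      by (rule quasi_surely_mono) auto
  next
    case (step u)
    show ?case
      by (rule quasi_surely_mono[OF one_step[OF step.hyps(2) step.IH]]) simp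
  qed
  then show "t \<le> T \<Longrightarrow> quasi_surely X E (\<lambda>\<omega>. Y t \<omega> = V t \<omega>)" .
  show "quasi_surely X E (\<lambda>\<omega>. Z t \<omega> = W t \<omega> \<and> Z' t \<omega> = W' t \<omega>)" if "t < T"
    using one_step[OF that YV] that by (auto elim: quasi_surely_mono)
qed

end

theorem theorem6p1:
  fixes K N M T :: nat
    and X :: "nat \<Rightarrow> 'w \<Rightarrow> real vec"
    and H :: "('w \<Rightarrow> real) set"
    and E :: "nat \<Rightarrow> ('w \<Rightarrow> real) \<Rightarrow> 'w \<Rightarrow> real"
    and \<phi>s \<phi>' :: "nat \<Rightarrow> 'w \<Rightarrow> real mat"
    and F :: "'w \<Rightarrow> nat \<Rightarrow> real vec \<Rightarrow> real mat \<Rightarrow> real mat \<Rightarrow> real vec"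
    and Q :: "'w \<Rightarrow> real vec"
  assumes "M < N"
    and "basis_process N X"
    and "test_space X H"
    and "SL_expectation X H E"
    and "basis_change N M X H E \<phi>s \<phi>'"
    and "driver K N M T X H E F"
    and "\<And>t z z'. t < T \<Longrightarrow> z \<in> carrier_mat K M \<Longrightarrow> z' \<in> carrier_mat K (N - M - 1) \<Longrightarrow>
           quasi_surely X E
             (\<lambda>\<omega>. bij_betw (\<lambda>y. y - F \<omega> t y z z') (carrier_vec K) (carrier_vec K))"
    and "\<And>\<omega>. Q \<omega> \<in> carrier_vec K"
    and "\<And>i. i < K \<Longrightarrow> (\<lambda>\<omega>. Q \<omega> $ i) \<in> L1_at X H E T"
  shows "(\<exists>Y Z Z'. BSDE_solution K N M T X H E \<phi>s \<phi>' F Q Y Z Z') \<and>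
         (nondegenerate N T X E \<longrightarrow>
           (\<forall>Y Z Z' V W W'.
              BSDE_solution K N M T X H E \<phi>s \<phi>' F Q Y Z Z' \<and>
              BSDE_solution K N M T X H E \<phi>s \<phi>' F Q V W W' \<longrightarrow>
              (\<forall>t\<le>T. quasi_surely X E (\<lambda>\<omega>. Y t \<omega> = V t \<omega>)) \<and>
              (\<forall>t<T. quasi_surely X E (\<lambda>\<omega>. Z t \<omega> = W t \<omega> \<and> Z' t \<omega> = W' t \<omega>))))"
proof -
  interpret bsde_setting N X H E M K \<phi>s \<phi>'
    using assms(1-5) by unfold_locales
  \<comment> \<open>Measurability is given per component and for fixed arguments; since the values
    lie in \<open>carrier_vec K\<close>, equal components give equal vectors along a
    history.\<close>
  have F: "regular_driver X E K M (N - M - 1) t F" if "t < T" for t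
    unfolding regular_driver_def
  proof (intro ballI conjI allI)
    fix y :: "real vec" and z z' :: "real mat"
    assume yz: "y \<in> carrier_vec K" "z \<in> carrier_mat K M" "z' \<in> carrier_mat K (N - M - 1)"
    show carrier: "F \<omega> t y z z' \<in> carrier_vec K" for \<omega>
      using assms(6) that yz by (simp add: driver_def)
    have "history_det X t (\<lambda>\<omega>. F \<omega> t y z z' $ i)" if "i < K" for i
      using assms(6) \<open>t < T\<close> yz that
      by (simp add: driver_def L1_at_def borel_measurable_filt_iff[OF basis])
    then show "history_det X t (\<lambda>\<omega>. F \<omega> t y z z')"
      unfolding history_det_def by (metis (no_types, lifting) carrier carrier_vecD eq_vecI)
  qed (use assms(7) that in auto)
  have "history_det X T (\<lambda>\<omega>. Q \<omega> $ i)" if "i < K" for i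
    using assms(9)[OF that] by (simp add: L1_at_def borel_measurable_filt_iff[OF basis])
  then have Q: "history_det X T Q"
    unfolding history_det_def by (metis (no_types, lifting) assms(8) carrier_vecD eq_vecI)
  show ?thesis
    using BSDE_exists[OF F Q assms(8)] BSDE_unique[OF F] by blast
qed

end
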